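(* Let $p\in(1,\infty)$ and $L>0$. Then for every $a\in\Lambda$, $$\|a\|_q\ \ge\ \begin{cases}\dfrac{2^p(p-1)(q-1)^{p-1+1/q}}{L^{p-1/q}\,q^{p-1}(pq-1)^{1/q}}\left(\displaystyle\int_0^{\pi_p/2}\frac{dx}{\sin_p^{1/q}x}\right)^p, & q\in(1,\infty),\\[12pt] (p-1)\left(\dfrac{\pi_p}{L}\right)^p, & q=\infty,\end{cases}$$ where, for $q\in(1,\infty)$, $$\int_0^{\pi_p/2}\frac{dx}{\sin_p^{1/q}x}=\frac{q^*\pi_{p,pq^*}}{2}=\frac1p B\!\left(\frac1{p^*},\frac1{pq^*}\right).$$ Moreover, the constants on the right-hand side are optimal and attained (that is, equality holds) by the element $a$ of $\Lambda$ given by $$a(x)=\begin{cases}(p-1)q^*\left(\dfrac{\pi_{p,pq^*}}{L}\right)^p\sin_{p,pq^*}^{p/(q-1)}\!\left(\dfrac{\pi_{p,pq^*}}{L}x\right), & q\in(1,\infty),\\[12pt] (p-1)\left(\dfrac{\pi_p}{L}\right)^p, & q=\infty,\end{cases}\qquad 0<x<L.$$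
   Context: For $s\in(1,\infty)$, $s^*:=s/(s-1)$. $B(\cdot,\cdot)$ is the beta function. $\Lambda$ is the set of all real-valued $a\in L^\infty(0,L)$ such that the boundary value problem $$-(|u'|^{p-2}u')'=a(x)|u|^{p-2}u\ \text{ on }(0,L),\qquad u(0)=u(L)=0$$ has a nontrivial solution, where a solution is a function $u\in W^{1,p}_0(0,L)$ satisfying the equation in the weak sense. $\|\cdot\|_q$ is the $L^q(0,L)$-norm, $q\in[1,\infty]$. For $p,q\in(1,\infty)$ define $\sin_{p,q}^{-1}x:=\int_0^x(1-t^q)^{-1/p}\,dt$ for $0\le x\le1$ and $\pi_{p,q}:=2\sin_{p,q}^{-1}1$. The function $\sin_{p,q}:[0,\pi_{p,q}/2]\to[0,1]$ is the inverse of $\sin_{p,q}^{-1}$, extended to $[0,\pi_{p,q}]$ by $\sin_{p,q}x:=\sin_{p,q}(\pi_{p,q}-x)$ for $x\in[\pi_{p,q}/2,\pi_{p,q}]$. Write $\sin_p:=\sin_{p,p}$, $\pi_p:=\pi_{p,p}$, and $\sin_{p,q}^{s}x=(\sin_{p,q}x)^s$. *)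

theory Defs
  imports "HOL-Analysis.Analysis" "HOL-Probability.Essential_Supremum"
begin

definition conj_exp :: "real \<Rightarrow> real" where
  "conj_exp s = s / (s - 1)"

section \<open>Lebesgue spaces\<close>

definition Lp_space :: "'a measure \<Rightarrow> real \<Rightarrow> ('a \<Rightarrow> real) set" where
  "Lp_space M q = {f \<in> borel_measurable M. integrable M (\<lambda>x. \<bar>f x\<bar> powr q)}"

text \<open>The two norms below are meaningful on the corresponding spaces only: outside of them
  the Bochner integral, respectively \<open>real_of_ereal\<close>, returns a default value.\<close>

definition Lp_norm :: "'a measure \<Rightarrow> real \<Rightarrow> ('a \<Rightarrow> real) \<Rightarrow> real" where
  "Lp_norm M q f = (LINT x|M. \<bar>f x\<bar> powr q) powr (1 / q)"

definition Linf_space :: "'a measure \<Rightarrow> ('a \<Rightarrow> real) set" where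
  "Linf_space M = {f \<in> borel_measurable M. \<exists>C. AE x in M. \<bar>f x\<bar> \<le> C}"

definition Linf_norm :: "'a measure \<Rightarrow> ('a \<Rightarrow> real) \<Rightarrow> real" where
  "Linf_norm M f = real_of_ereal (esssup M (\<lambda>x. ereal \<bar>f x\<bar>))"

abbreviation leb_int :: "real \<Rightarrow> real measure" where
  "leb_int L \<equiv> lebesgue_on {0<..<L}"

section \<open>The Sobolev space with zero boundary values\<close>

definition test_functions :: "real \<Rightarrow> (real \<Rightarrow> real) set" where
  "test_functions L = {\<phi>. (\<forall>n x. (deriv ^^ n) \<phi> field_differentiable at x)
     \<and> compact (closure {x. \<phi> x \<noteq> 0}) \<and> closure {x. \<phi> x \<noteq> 0} \<subseteq> {0<..<L}}"

text \<open>Used only for \<open>u\<close> and \<open>g\<close> in \<open>Lp_space (leb_int L) p\<close> with \<open>p > 1\<close>, so that both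
  integrals converge.\<close>

definition weak_deriv :: "real \<Rightarrow> (real \<Rightarrow> real) \<Rightarrow> (real \<Rightarrow> real) \<Rightarrow> bool" where
  "weak_deriv L u g \<longleftrightarrow> (\<forall>\<phi>\<in>test_functions L.
     (LINT x|leb_int L. u x * deriv \<phi> x) = - (LINT x|leb_int L. g x * \<phi> x))"

text \<open>The closure of the test functions in \<open>W\<^sup>1\<^sup>,\<^sup>p(0,L)\<close>. Elements are representatives,
  i.e. functions that are relevant only up to null sets of \<open>(0,L)\<close>.\<close>

definition W1p0 :: "real \<Rightarrow> real \<Rightarrow> (real \<Rightarrow> real) set" where
  "W1p0 p L = {u \<in> Lp_space (leb_int L) p.
     \<exists>g\<in>Lp_space (leb_int L) p. weak_deriv L u g \<and>
       (\<exists>\<phi> :: nat \<Rightarrow> real \<Rightarrow> real. (\<forall>n. \<phi> n \<in> test_functions L) \<and>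
          (\<lambda>n. Lp_norm (leb_int L) p (\<lambda>x. \<phi> n x - u x)) \<longlonglongrightarrow> 0 \<and>
          (\<lambda>n. Lp_norm (leb_int L) p (\<lambda>x. deriv (\<phi> n) x - g x)) \<longlonglongrightarrow> 0)}"

section \<open>The boundary value problem\<close>

text \<open>Here \<open>0 powr (p - 2) * 0 = 0\<close>, which is the usual convention for \<open>p < 2\<close>.
  The weak derivative \<open>g\<close> is unique up to a null set, so the choice of \<open>g\<close> does not matter.\<close>

definition weak_solution :: "real \<Rightarrow> real \<Rightarrow> (real \<Rightarrow> real) \<Rightarrow> (real \<Rightarrow> real) \<Rightarrow> bool" where
  "weak_solution p L a u \<longleftrightarrow> u \<in> W1p0 p L \<and>
     (\<exists>g\<in>Lp_space (leb_int L) p. weak_deriv L u g \<and>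
       (\<forall>\<phi>\<in>test_functions L.
          (LINT x|leb_int L. \<bar>g x\<bar> powr (p - 2) * g x * deriv \<phi> x)
          = (LINT x|leb_int L. a x * \<bar>u x\<bar> powr (p - 2) * u x * \<phi> x)))"

definition Lambda :: "real \<Rightarrow> real \<Rightarrow> (real \<Rightarrow> real) set" where
  "Lambda p L = {a \<in> Linf_space (leb_int L).
     \<exists>u. weak_solution p L a u \<and> \<not> (AE x in leb_int L. u x = 0)}"

section \<open>Generalized trigonometric functions\<close>

definition arcsin_pq :: "real \<Rightarrow> real \<Rightarrow> real \<Rightarrow> real" where
  "arcsin_pq p q x = (LBINT t:{0..x}. (1 - t powr q) powr (- 1 / p))"

definition pi_pq :: "real \<Rightarrow> real \<Rightarrow> real" where
  "pi_pq p q = 2 * arcsin_pq p q 1"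

text \<open>Meaningful for \<open>x\<close> in \<open>{0..pi_pq p q}\<close> only.\<close>

definition sin_pq :: "real \<Rightarrow> real \<Rightarrow> real \<Rightarrow> real" where
  "sin_pq p q x = inv_into {0..1} (arcsin_pq p q)
     (if x \<le> pi_pq p q / 2 then x else pi_pq p q - x)"

abbreviation sin_p :: "real \<Rightarrow> real \<Rightarrow> real" where
  "sin_p p \<equiv> sin_pq p p"

abbreviation pi_p :: "real \<Rightarrow> real" where
  "pi_p p \<equiv> pi_pq p p"

section \<open>The optimal constants and the extremal weights\<close>

definition sin_p_integral :: "real \<Rightarrow> real \<Rightarrow> real" where
  "sin_p_integral p q = (LBINT x:{0..pi_p p / 2}. 1 / sin_p p x powr (1 / q))"

definition bound_q :: "real \<Rightarrow> real \<Rightarrow> real \<Rightarrow> real" where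
  "bound_q p L q =
     (2 powr p * (p - 1) * (q - 1) powr (p - 1 + 1 / q))
     / (L powr (p - 1 / q) * q powr (p - 1) * (p * q - 1) powr (1 / q))
     * sin_p_integral p q powr p"

definition bound_inf :: "real \<Rightarrow> real \<Rightarrow> real" where
  "bound_inf p L = (p - 1) * (pi_p p / L) powr p"

definition extremal_q :: "real \<Rightarrow> real \<Rightarrow> real \<Rightarrow> real \<Rightarrow> real" where
  "extremal_q p L q x =
     (let r = p * conj_exp q
      in (p - 1) * conj_exp q * (pi_pq p r / L) powr p
         * sin_pq p r (pi_pq p r / L * x) powr (p / (q - 1)))"

definition extremal_inf :: "real \<Rightarrow> real \<Rightarrow> real \<Rightarrow> real" where
  "extremal_inf p L x = (p - 1) * (pi_p p / L) powr p"

end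

theory Submission
  imports Defs
begin

text \<open>If \<open>u\<close> solves the boundary value problem with weight \<open>a\<close>, testing the equation with \<open>u\<close> itself and
applying Hoelder's inequality gives
\<open>\<integral>|u'|\<^sup>p = \<integral>a |u|\<^sup>p \<le> \<parallel>a\<parallel>\<^sub>q (\<integral>|u|\<^sup>r)\<^bsup>p/r\<^esup>\<close> with \<open>r = p q\<^sup>*\<close>
(and \<open>r = p\<close> for \<open>q = \<infinity>\<close>). Hence \<open>\<parallel>a\<parallel>\<^sub>q\<close> is at least the best constant \<open>K\<close> in the Sobolev inequality
\<open>K (\<integral>|u|\<^sup>r)\<^bsup>p/r\<^esup> \<le> \<integral>|u'|\<^sup>p\<close> on \<open>(0,L)\<close>.

The constant \<open>K\<close> comes from a short one-dimensional argument (\<open>sharp_Sobolev_inequality\<close>).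
Let \<open>M\<close> be the maximum of \<open>|u|\<close>. The normalized function \<open>u / M\<close> runs from \<open>0\<close> to \<open>\<plusminus>1\<close> and back, so
\<open>2 J M \<le> \<integral>|u'| (1 - |u/M|\<^sup>r)\<^bsup>1/p*\<^esup>\<close> with \<open>J = \<integral>\<^sub>0\<^sup>1 (1 - t\<^sup>r)\<^bsup>1/p*\<^esup> dt\<close>.
By Hoelder's inequality the right-hand side is at most \<open>(\<integral>|u'|\<^sup>p)\<^bsup>1/p\<^esup> (L - X)\<^bsup>1/p*\<^esup>\<close>, where
\<open>X = \<integral>|u|\<^sup>r / M\<^sup>r\<close>. Solving for \<open>\<integral>|u'|\<^sup>p\<close> leaves the factor \<open>X\<^bsup>p/r\<^esup> (L - X)\<^bsup>p-1\<^esup>\<close>, which is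
maximal at one explicit \<open>X\<close> by the weighted inequality of the means.

Equality in every step forces \<open>u' = \<plusminus>c (1 - u\<^sup>r)\<^bsup>1/p\<^esup>\<close>, that is
\<open>u(x) = sin\<^sub>p\<^sub>,\<^sub>r(\<pi>\<^sub>p\<^sub>,\<^sub>r x / L)\<close>. This function solves the boundary value problem for the extremal weight
(\<open>scaled_sin_weight_in_Lambda\<close>), and multiplying its equation by \<open>u\<close> yields \<open>\<integral>u\<^sup>r\<close>, and with it the
norm of that weight, without evaluating a further integral. All remaining integrals become Beta integrals under \<open>y = t\<^sup>r\<close>,
which identifies \<open>K\<close> with the constants of the theorem (\<open>bound_q_eq_sobolev_const\<close>,
\<open>bound_inf_eq_sobolev_const\<close>).

The space \<open>W1p0\<close> is defined through limits of test functions. For the lower bound this is convenient: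
the Sobolev inequality is needed for test functions only, and the limits are limits of integrals against
a bounded weight in \<open>L\<^sup>p\<close>. The price is that the weak derivative must be shown to be unique
(\<open>weak_deriv_unique\<close>), and that the extremal function must be approximated by test functions
(\<open>W1p0I\<close>), for which a supply of smooth functions of compact support is constructed.\<close>

section \<open>Hoelder's inequality and convergence in \<open>L\<^sup>p\<close>\<close>

lemma Lp_norm_nonneg: "0 \<le> Lp_norm M p f"
  by (simp add: Lp_norm_def)

lemma Lp_norm_powr:
  assumes "0 < p"
  shows "Lp_norm M p f powr p = (LINT x|M. \<bar>f x\<bar> powr p)"
  using assms by (simp add: Lp_norm_def powr_powr)

lemma Lp_norm_zero_AE:
  assumes "f \<in> Lp_space M p" "0 < p" "Lp_norm M p f = 0"
  shows "AE x in M. f x = 0"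
proof -
  have "(LINT x|M. \<bar>f x\<bar> powr p) = 0"
    using assms(3) by (simp add: Lp_norm_def)
  then have "AE x in M. \<bar>f x\<bar> powr p = 0"
    using assms(1) by (subst (asm) integral_nonneg_eq_0_iff_AE) (auto simp: Lp_space_def)
  then show ?thesis by simp
qed

text \<open>Young's inequality applied to \<open>|f| / \<parallel>f\<parallel>\<^sub>p\<close> and \<open>|g| / \<parallel>g\<parallel>\<^sub>q\<close> and integrated; if one of the norms
vanishes, the product is zero almost everywhere.\<close>

lemma Hoelder_inequality:
  assumes pq: "1 < p" "1 < q" "1 / p + 1 / q = 1"
    and f: "f \<in> Lp_space M p" and g: "g \<in> Lp_space M q"
  shows "integrable M (\<lambda>x. f x * g x)"
    and "(LINT x|M. \<bar>f x * g x\<bar>) \<le> Lp_norm M p f * Lp_norm M q g"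
proof -
  have [measurable]: "f \<in> borel_measurable M" "g \<in> borel_measurable M"
    and fi: "integrable M (\<lambda>x. \<bar>f x\<bar> powr p)" and gi: "integrable M (\<lambda>x. \<bar>g x\<bar> powr q)"
    using f g by (auto simp: Lp_space_def)
  show int: "integrable M (\<lambda>x. f x * g x)"
  proof (rule Bochner_Integration.integrable_bound)
    show "integrable M (\<lambda>x. \<bar>f x\<bar> powr p / p + \<bar>g x\<bar> powr q / q)"
      using fi gi by simp
    show "AE x in M. norm (f x * g x) \<le> norm (\<bar>f x\<bar> powr p / p + \<bar>g x\<bar> powr q / q)"
    proof (rule AE_I2)
      fix x
      have "\<bar>f x\<bar> * \<bar>g x\<bar> \<le> \<bar>f x\<bar> powr p / p + \<bar>g x\<bar> powr q / q"
        using pq by (intro Youngs_inequality) auto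
      then show "norm (f x * g x) \<le> norm (\<bar>f x\<bar> powr p / p + \<bar>g x\<bar> powr q / q)"
        by (simp add: abs_mult)
    qed
  qed simp
  let ?A = "Lp_norm M p f" and ?B = "Lp_norm M q g"
  show "(LINT x|M. \<bar>f x * g x\<bar>) \<le> ?A * ?B"
  proof (cases "?A = 0 \<or> ?B = 0")
    case True
    have "AE x in M. \<bar>f x * g x\<bar> = 0"
      using True
    proof
      assume "?A = 0"
      then have "AE x in M. f x = 0" using Lp_norm_zero_AE[OF f] pq by simp
      then show ?thesis by eventually_elim simp
    next
      assume "?B = 0"
      then have "AE x in M. g x = 0" using Lp_norm_zero_AE[OF g] pq by simp
      then show ?thesis by eventually_elim simp
    qed
    then have "(LINT x|M. \<bar>f x * g x\<bar>) = 0"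
      by (intro integral_eq_zero_AE)
    then show ?thesis by (simp add: Lp_norm_nonneg)
  next
    case False
    then have pos: "?A > 0" "?B > 0"
      by (auto simp: less_le Lp_norm_nonneg)
    have "(LINT x|M. \<bar>f x * g x\<bar> / (?A * ?B))
        \<le> (LINT x|M. \<bar>f x\<bar> powr p / ?A powr p / p + \<bar>g x\<bar> powr q / ?B powr q / q)"
    proof (rule integral_mono)
      fix x
      have "(\<bar>f x\<bar> / ?A) * (\<bar>g x\<bar> / ?B) \<le> (\<bar>f x\<bar> / ?A) powr p / p + (\<bar>g x\<bar> / ?B) powr q / q"
        using pq pos by (intro Youngs_inequality) auto
      then show "\<bar>f x * g x\<bar> / (?A * ?B) \<le> \<bar>f x\<bar> powr p / ?A powr p / p + \<bar>g x\<bar> powr q / ?B powr q / q"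
        using pos by (simp add: abs_mult powr_divide)
    qed (use int fi gi in auto)
    also have "\<dots> = 1 / p + 1 / q"
      using fi gi pos pq by (simp flip: Lp_norm_powr)
    finally show ?thesis
      using pos pq by (simp add: field_simps)
  qed
qed

lemma powr_add_le:
  fixes x y p :: real
  assumes "0 \<le> x" "0 \<le> y" "0 < p"
  shows "(x + y) powr p \<le> 2 powr p * (x powr p + y powr p)"
proof -
  have "(x + y) powr p \<le> (2 * max x y) powr p"
    using assms by (intro powr_mono2) auto
  also have "\<dots> = 2 powr p * max x y powr p"
    using assms by (simp add: powr_mult)
  also have "\<dots> \<le> 2 powr p * (x powr p + y powr p)"
    by (intro mult_left_mono) (auto simp: max_def)
  finally show ?thesis .
qed

lemma Lp_space_add:
  assumes "0 < p" "f \<in> Lp_space M p" "g \<in> Lp_space M p"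
  shows "(\<lambda>x. f x + g x) \<in> Lp_space M p"
proof -
  have [measurable]: "f \<in> borel_measurable M" "g \<in> borel_measurable M"
    and fi: "integrable M (\<lambda>x. \<bar>f x\<bar> powr p)" and gi: "integrable M (\<lambda>x. \<bar>g x\<bar> powr p)"
    using assms by (auto simp: Lp_space_def)
  have "integrable M (\<lambda>x. \<bar>f x + g x\<bar> powr p)"
  proof (rule Bochner_Integration.integrable_bound)
    show "integrable M (\<lambda>x. 2 powr p * (\<bar>f x\<bar> powr p + \<bar>g x\<bar> powr p))"
      using fi gi by simp
    show "AE x in M. norm (\<bar>f x + g x\<bar> powr p) \<le> norm (2 powr p * (\<bar>f x\<bar> powr p + \<bar>g x\<bar> powr p))"
    proof (rule AE_I2)
      fix x
      have "\<bar>f x + g x\<bar> powr p \<le> (\<bar>f x\<bar> + \<bar>g x\<bar>) powr p"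
        using assms by (intro powr_mono2) auto
      also have "\<dots> \<le> 2 powr p * (\<bar>f x\<bar> powr p + \<bar>g x\<bar> powr p)"
        using assms by (intro powr_add_le) auto
      finally show "norm (\<bar>f x + g x\<bar> powr p) \<le> norm (2 powr p * (\<bar>f x\<bar> powr p + \<bar>g x\<bar> powr p))"
        by simp
    qed
  qed simp
  then show ?thesis by (simp add: Lp_space_def)
qed

lemma Lp_space_diff:
  assumes "0 < p" "f \<in> Lp_space M p" "g \<in> Lp_space M p"
  shows "(\<lambda>x. f x - g x) \<in> Lp_space M p"
  using Lp_space_add[of p f M "\<lambda>x. - g x"] assms by (simp add: Lp_space_def)

text \<open>Strong convergence in \<open>L\<^sup>p\<close> implies weak convergence. This carries the weak equation, which is known
for test functions, over to the solution as its own test function.\<close>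

lemma Lp_tendsto_integral_mult:
  assumes pq: "1 < p" "1 < q" "1 / p + 1 / q = 1"
    and F: "\<And>n. F n \<in> Lp_space M p" and f: "f \<in> Lp_space M p" and h: "h \<in> Lp_space M q"
    and lim: "(\<lambda>n. Lp_norm M p (\<lambda>x. F n x - f x)) \<longlonglongrightarrow> 0"
  shows "(\<lambda>n. LINT x|M. h x * F n x) \<longlonglongrightarrow> (LINT x|M. h x * f x)"
proof -
  have bd: "\<bar>(LINT x|M. h x * F n x) - (LINT x|M. h x * f x)\<bar>
      \<le> Lp_norm M p (\<lambda>x. F n x - f x) * Lp_norm M q h" for n
  proof -
    have D: "(\<lambda>x. F n x - f x) \<in> Lp_space M p"
      using pq F f by (intro Lp_space_diff) auto
    have "(LINT x|M. h x * F n x) - (LINT x|M. h x * f x) = (LINT x|M. F n x * h x - f x * h x)"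
      using Hoelder_inequality(1)[OF pq F h] Hoelder_inequality(1)[OF pq f h]
      by (subst Bochner_Integration.integral_diff) (auto simp: mult.commute)
    also have "\<dots> = (LINT x|M. (F n x - f x) * h x)"
      by (simp add: algebra_simps)
    finally have "\<bar>(LINT x|M. h x * F n x) - (LINT x|M. h x * f x)\<bar> \<le> (LINT x|M. \<bar>(F n x - f x) * h x\<bar>)"
      by (simp add: integral_abs_bound)
    then show ?thesis
      using Hoelder_inequality(2)[OF pq D h] by linarith
  qed
  have "(\<lambda>n. (LINT x|M. h x * F n x) - (LINT x|M. h x * f x)) \<longlonglongrightarrow> 0"
  proof (rule Lim_null_comparison)
    show "\<forall>\<^sub>F n in sequentially. norm ((LINT x|M. h x * F n x) - (LINT x|M. h x * f x))
        \<le> Lp_norm M p (\<lambda>x. F n x - f x) * Lp_norm M q h"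
      using bd by simp
    show "(\<lambda>n. Lp_norm M p (\<lambda>x. F n x - f x) * Lp_norm M q h) \<longlonglongrightarrow> 0"
      using tendsto_mult_right[OF lim, of "Lp_norm M q h"] by simp
  qed
  then show ?thesis by (simp add: LIM_zero_iff)
qed

lemma powr_diff_le:
  fixes x y p :: real
  assumes "0 \<le> x" "0 \<le> y" "1 < p"
  shows "\<bar>x powr p - y powr p\<bar> \<le> p * \<bar>x - y\<bar> * (x powr (p - 1) + y powr (p - 1))"
proof -
  have *: "y powr p - x powr p \<le> p * (y - x) * (x powr (p - 1) + y powr (p - 1))"
    if "0 \<le> x" "x < y" for x y :: real
  proof -
    have "continuous_on {x..y} (\<lambda>t. t powr p)"
      using assms(3) that by (intro continuous_on_powr') (auto intro: continuous_intros)
    moreover have "((\<lambda>t. t powr p) has_real_derivative p * t powr (p - 1)) (at t)"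
      if "x < t" "t < y" for t
      using that \<open>0 \<le> x\<close> by (auto intro!: derivative_eq_intros)
    ultimately obtain l z where z: "x < z" "z < y" "y powr p - x powr p = (y - x) * l"
      and l: "((\<lambda>t. t powr p) has_real_derivative l) (at z)"
      using MVT[of x y "\<lambda>t. t powr p"] \<open>x < y\<close> by (force simp: real_differentiable_def)
    have "((\<lambda>t. t powr p) has_real_derivative p * z powr (p - 1)) (at z)"
      using z \<open>0 \<le> x\<close> by (auto intro!: derivative_eq_intros)
    then have "l = p * z powr (p - 1)"
      using l DERIV_unique by blast
    moreover have "z powr (p - 1) \<le> x powr (p - 1) + y powr (p - 1)"
      using z \<open>0 \<le> x\<close> assms by (smt (verit) powr_ge_zero powr_mono2)
    ultimately show ?thesis
      using z \<open>x < y\<close> assms by (simp add: mult_left_mono)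
  qed
  consider "x < y" | "x = y" | "y < x" by linarith
  then show ?thesis
  proof cases
    case 1
    then have "x powr p \<le> y powr p" using assms by (intro powr_mono2) auto
    then show ?thesis using *[of x y] 1 assms by simp
  next
    case 3
    then have "y powr p \<le> x powr p" using assms by (intro powr_mono2) auto
    then show ?thesis using *[of y x] 3 assms by (simp add: add.commute)
  qed simp
qed

lemma Lp_space_powr_conj:
  assumes pq: "1 < p" "1 < q" "1 / p + 1 / q = 1" and f: "f \<in> Lp_space M p"
  shows "(\<lambda>x. \<bar>f x\<bar> powr (p - 1)) \<in> Lp_space M q"
    and "Lp_norm M q (\<lambda>x. \<bar>f x\<bar> powr (p - 1)) = Lp_norm M p f powr (p - 1)"
proof -
  have e: "(p - 1) * q = p" "1 / q = (p - 1) / p"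
    using pq by (simp_all add: field_simps)
  have "f \<in> borel_measurable M" using f by (simp add: Lp_space_def)
  then show "(\<lambda>x. \<bar>f x\<bar> powr (p - 1)) \<in> Lp_space M q"
    using f by (simp add: Lp_space_def powr_powr e)
  show "Lp_norm M q (\<lambda>x. \<bar>f x\<bar> powr (p - 1)) = Lp_norm M p f powr (p - 1)"
    unfolding Lp_norm_def by (simp add: powr_powr e)
qed

text \<open>The weight may change sign, so this is not a statement about norms. By \<open>powr_diff_le\<close> the integrands differ by at most
\<open>C p |F\<^sub>n - f| (|F\<^sub>n|\<^bsup>p-1\<^esup> + |f|\<^bsup>p-1\<^esup>)\<close>, and Hoelder's inequality bounds the integral of this by
\<open>\<parallel>F\<^sub>n - f\<parallel>\<^sub>p\<close> times a quantity that stays bounded in \<open>n\<close>.\<close>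

lemma Lp_tendsto_weighted_power:
  assumes p: "1 < p" and w[measurable]: "w \<in> borel_measurable M" and C: "AE x in M. \<bar>w x\<bar> \<le> C"
    and F: "\<And>n. F n \<in> Lp_space M p" and f: "f \<in> Lp_space M p"
    and lim: "(\<lambda>n. Lp_norm M p (\<lambda>x. F n x - f x)) \<longlonglongrightarrow> 0"
  shows "(\<lambda>n. LINT x|M. w x * \<bar>F n x\<bar> powr p) \<longlonglongrightarrow> (LINT x|M. w x * \<bar>f x\<bar> powr p)"
proof -
  define q where "q = p / (p - 1)"
  have pq: "1 < p" "1 < q" "1 / p + 1 / q = 1"
    using p by (auto simp: q_def field_simps)
  have [measurable]: "F n \<in> borel_measurable M" "f \<in> borel_measurable M" for n
    using F f by (auto simp: Lp_space_def)
  have wint: "integrable M (\<lambda>x. w x * \<bar>g x\<bar> powr p)" if "g \<in> Lp_space M p" for g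
  proof (rule Bochner_Integration.integrable_bound)
    show "integrable M (\<lambda>x. C * \<bar>g x\<bar> powr p)"
      using that by (simp add: Lp_space_def)
    have [measurable]: "g \<in> borel_measurable M"
      using that by (simp add: Lp_space_def)
    show "(\<lambda>x. w x * \<bar>g x\<bar> powr p) \<in> borel_measurable M"
      by measurable
    show "AE x in M. norm (w x * \<bar>g x\<bar> powr p) \<le> norm (C * \<bar>g x\<bar> powr p)"
      using C by eventually_elim (simp add: abs_mult mult_right_mono)
  qed
  let ?D = "\<lambda>n. Lp_norm M p (\<lambda>x. F n x - f x)"
  let ?P = "\<lambda>n x. \<bar>F n x\<bar> powr (p - 1)" and ?Q = "\<lambda>x. \<bar>f x\<bar> powr (p - 1)"
  \<comment> \<open>A bound for the norms of those \<open>F\<^sub>n\<close> with \<open>\<parallel>F\<^sub>n - f\<parallel>\<^sub>p \<le> 1\<close>.\<close>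
  define N where "N = (2 powr p * (1 + Lp_norm M p f powr p)) powr (1 / p)"
  have bd: "\<bar>(LINT x|M. w x * \<bar>F n x\<bar> powr p) - (LINT x|M. w x * \<bar>f x\<bar> powr p)\<bar>
      \<le> \<bar>C\<bar> * p * (?D n * (N powr (p - 1) + Lp_norm M p f powr (p - 1)))" if n: "?D n \<le> 1" for n
  proof -
    have D: "(\<lambda>x. F n x - f x) \<in> Lp_space M p"
      using pq F f by (intro Lp_space_diff) auto
    have "(LINT x|M. \<bar>F n x\<bar> powr p) \<le> (LINT x|M. 2 powr p * (\<bar>F n x - f x\<bar> powr p + \<bar>f x\<bar> powr p))"
    proof (rule integral_mono)
      fix x
      have "\<bar>F n x\<bar> powr p \<le> (\<bar>F n x - f x\<bar> + \<bar>f x\<bar>) powr p"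
        using p by (intro powr_mono2) auto
      also have "\<dots> \<le> 2 powr p * (\<bar>F n x - f x\<bar> powr p + \<bar>f x\<bar> powr p)"
        using p by (intro powr_add_le) auto
      finally show "\<bar>F n x\<bar> powr p \<le> 2 powr p * (\<bar>F n x - f x\<bar> powr p + \<bar>f x\<bar> powr p)" .
    qed (use F[of n] f D in \<open>auto simp: Lp_space_def\<close>)
    also have "\<dots> = 2 powr p * (?D n powr p + Lp_norm M p f powr p)"
      using f D p by (simp add: Lp_norm_powr Lp_space_def)
    also have "\<dots> \<le> 2 powr p * (1 + Lp_norm M p f powr p)"
      using n p Lp_norm_nonneg[of M p "\<lambda>x. F n x - f x"] by (simp add: powr_le1)
    finally have FN: "Lp_norm M p (F n) \<le> N"
      unfolding N_def Lp_norm_def[of M p "F n"] using p by (intro powr_mono2) auto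
    have i1: "integrable M (\<lambda>x. (F n x - f x) * ?P n x)"
      and i2: "integrable M (\<lambda>x. (F n x - f x) * ?Q x)"
      using Hoelder_inequality(1)[OF pq D Lp_space_powr_conj(1)[OF pq F]]
        Hoelder_inequality(1)[OF pq D Lp_space_powr_conj(1)[OF pq f]] by auto
    have i1': "integrable M (\<lambda>x. \<bar>(F n x - f x) * ?P n x\<bar>)"
      and i2': "integrable M (\<lambda>x. \<bar>(F n x - f x) * ?Q x\<bar>)"
      using i1 i2 by (auto intro: integrable_abs)
    have "(LINT x|M. w x * \<bar>F n x\<bar> powr p) - (LINT x|M. w x * \<bar>f x\<bar> powr p)
        = (LINT x|M. w x * \<bar>F n x\<bar> powr p - w x * \<bar>f x\<bar> powr p)"
      using wint F f by simp
    also have "\<bar>\<dots>\<bar> \<le> (LINT x|M. \<bar>w x * \<bar>F n x\<bar> powr p - w x * \<bar>f x\<bar> powr p\<bar>)"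
      by (rule integral_abs_bound)
    also have "\<dots> \<le> (LINT x|M. \<bar>C\<bar> * p * (\<bar>(F n x - f x) * ?P n x\<bar> + \<bar>(F n x - f x) * ?Q x\<bar>))"
    proof (rule integral_mono_AE)
      show "AE x in M. \<bar>w x * \<bar>F n x\<bar> powr p - w x * \<bar>f x\<bar> powr p\<bar>
          \<le> \<bar>C\<bar> * p * (\<bar>(F n x - f x) * ?P n x\<bar> + \<bar>(F n x - f x) * ?Q x\<bar>)"
        using C
      proof eventually_elim
        case (elim x)
        have "\<bar>\<bar>F n x\<bar> powr p - \<bar>f x\<bar> powr p\<bar> \<le> p * \<bar>\<bar>F n x\<bar> - \<bar>f x\<bar>\<bar> * (?P n x + ?Q x)"
          using p by (intro powr_diff_le) auto
        also have "\<dots> \<le> p * \<bar>F n x - f x\<bar> * (?P n x + ?Q x)"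
          using p by (intro mult_right_mono mult_left_mono) auto
        finally have e: "\<bar>\<bar>F n x\<bar> powr p - \<bar>f x\<bar> powr p\<bar> \<le> p * \<bar>F n x - f x\<bar> * (?P n x + ?Q x)" .
        have "\<bar>w x * \<bar>F n x\<bar> powr p - w x * \<bar>f x\<bar> powr p\<bar> = \<bar>w x\<bar> * \<bar>\<bar>F n x\<bar> powr p - \<bar>f x\<bar> powr p\<bar>"
          by (simp add: abs_mult flip: right_diff_distrib)
        also have "\<dots> \<le> \<bar>C\<bar> * (p * \<bar>F n x - f x\<bar> * (?P n x + ?Q x))"
          using elim e by (intro mult_mono) auto
        finally show ?case
          unfolding abs_mult[of "F n x - f x"] by (simp add: algebra_simps)
      qed
    qed (use wint F f i1' i2' in auto)
    also have "\<dots> = \<bar>C\<bar> * p * ((LINT x|M. \<bar>(F n x - f x) * ?P n x\<bar>) + (LINT x|M. \<bar>(F n x - f x) * ?Q x\<bar>))"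
      using i1' i2' by simp
    also have "\<dots> \<le> \<bar>C\<bar> * p * (?D n * Lp_norm M p (F n) powr (p - 1) + ?D n * Lp_norm M p f powr (p - 1))"
      using Hoelder_inequality(2)[OF pq D Lp_space_powr_conj(1)[OF pq F[of n]]]
        Hoelder_inequality(2)[OF pq D Lp_space_powr_conj(1)[OF pq f]] p
      unfolding Lp_space_powr_conj(2)[OF pq F] Lp_space_powr_conj(2)[OF pq f]
      by (intro mult_left_mono add_mono) auto
    also have "\<dots> \<le> \<bar>C\<bar> * p * (?D n * N powr (p - 1) + ?D n * Lp_norm M p f powr (p - 1))"
      using FN p by (intro mult_left_mono add_mono powr_mono2) (auto simp: Lp_norm_nonneg)
    finally show ?thesis by (simp add: algebra_simps)
  qed
  have "(\<lambda>n. (LINT x|M. w x * \<bar>F n x\<bar> powr p) - (LINT x|M. w x * \<bar>f x\<bar> powr p)) \<longlonglongrightarrow> 0"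
  proof (rule Lim_null_comparison)
    have "\<forall>\<^sub>F n in sequentially. ?D n < 1"
      using lim by (rule order_tendstoD) simp
    then show "\<forall>\<^sub>F n in sequentially. norm ((LINT x|M. w x * \<bar>F n x\<bar> powr p) - (LINT x|M. w x * \<bar>f x\<bar> powr p))
        \<le> \<bar>C\<bar> * p * (?D n * (N powr (p - 1) + Lp_norm M p f powr (p - 1)))"
      by eventually_elim (use bd in auto)
    show "(\<lambda>n. \<bar>C\<bar> * p * (?D n * (N powr (p - 1) + Lp_norm M p f powr (p - 1)))) \<longlonglongrightarrow> 0"
      using tendsto_mult_left[OF tendsto_mult_right[OF lim, of "N powr (p - 1) + Lp_norm M p f powr (p - 1)"], of "\<bar>C\<bar> * p"]
      by simp
  qed
  then show ?thesis by (simp add: LIM_zero_iff)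
qed

section \<open>Beta integrals after a power substitution\<close>

lemma powr_less_one':
  fixes x q :: real
  assumes "0 \<le> x" "x < 1" "0 < q"
  shows "x powr q < 1"
  using powr_less_mono2[of q x 1] assms by simp

text \<open>The substitution \<open>y = t\<^sup>r\<close> in Euler's Beta integral. The three choices \<open>(r,a,b)\<close> that occur below yield
the value of \<open>\<pi>\<^sub>p\<^sub>,\<^sub>q\<close>, the constant \<open>J\<close> of the Sobolev inequality, and the integral of \<open>sin\<^sub>p\<^bsup>-1/q\<^esup>\<close>.\<close>

lemma Beta_powr_substitution:
  fixes r a b :: real
  assumes "0 < r" "0 < a" "0 < b"
  shows "((\<lambda>t. t powr (r * a - 1) * (1 - t powr r) powr (b - 1)) has_integral Beta a b / r) {0<..<1}"
proof -
  let ?f = "\<lambda>y::real. y powr (a - 1) * (1 - y) powr (b - 1)"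
  have f: "(?f has_integral Beta a b) {0<..<1}"
    using has_integral_Beta_real[of a b] assms by (simp add: has_integral_Icc_iff_Ioo)
  have im: "(\<lambda>t. t powr r) ` {0<..<1} = {0<..<1::real}"
  proof (intro set_eqI iffI)
    fix y :: real assume "y \<in> {0<..<1}"
    then show "y \<in> (\<lambda>t. t powr r) ` {0<..<1}"
      using assms by (intro image_eqI[of _ _ "y powr (1 / r)"]) (auto simp: powr_powr powr_less_one')
  qed (use assms in \<open>auto simp: powr_less_one'\<close>)
  have "?f absolutely_integrable_on {0<..<1}"
    using f by (intro nonnegative_absolutely_integrable_1) auto
  moreover have "((\<lambda>t. t powr r) has_field_derivative r * t powr (r - 1)) (at t within {0<..<1})"
    if "t \<in> {0<..<1::real}" for t
    using that by (auto intro!: derivative_eq_intros)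
  moreover have "inj_on (\<lambda>t. t powr r) {0<..<1::real}"
    using assms by (intro inj_on_inverseI[of _ "\<lambda>y. y powr (1 / r)"]) (auto simp: powr_powr)
  ultimately have *: "(\<lambda>t. \<bar>r * t powr (r - 1)\<bar> * ?f (t powr r)) absolutely_integrable_on {0<..<1}"
    "integral {0<..<1} (\<lambda>t. \<bar>r * t powr (r - 1)\<bar> * ?f (t powr r)) = Beta a b"
    using has_absolute_integral_change_of_variables_1'[of "{0<..<1}" "\<lambda>t. t powr r" "\<lambda>t. r * t powr (r - 1)" ?f "Beta a b"]
      f im by (auto simp: integral_unique)
  have "((\<lambda>t. \<bar>r * t powr (r - 1)\<bar> * ?f (t powr r)) has_integral Beta a b) {0<..<1}"
    using * by (simp add: has_integral_iff absolutely_integrable_on_def)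
  then have "((\<lambda>t. \<bar>r * t powr (r - 1)\<bar> * ?f (t powr r) / r) has_integral Beta a b / r) {0<..<1}"
    by (rule has_integral_divide)
  then show ?thesis
  proof (rule has_integral_eq[rotated])
    fix t :: real assume t: "t \<in> {0<..<1}"
    have "t powr (r - 1) * (t powr r) powr (a - 1) = t powr (r * a - 1)"
      by (simp add: powr_powr algebra_simps flip: powr_add)
    then show "\<bar>r * t powr (r - 1)\<bar> * ?f (t powr r) / r = t powr (r * a - 1) * (1 - t powr r) powr (b - 1)"
      using assms t by (simp add: field_simps)
  qed
qed

text \<open>Improper integrals are computed with the gauge integral; for nonnegative integrands the result is also the Lebesgue
integral in which the trigonometric functions are defined.\<close>

lemma nonneg_has_integral_imp_set_integrable:
  fixes f :: "real \<Rightarrow> real"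
  assumes [measurable]: "f \<in> borel_measurable borel" and S[measurable]: "S \<in> sets borel"
    and "(f has_integral I) S" and "\<And>x. x \<in> S \<Longrightarrow> 0 \<le> f x"
  shows "set_integrable lborel S f" and "(LBINT x:S. f x) = I"
proof -
  have "f absolutely_integrable_on S"
    using assms by (intro nonnegative_absolutely_integrable_1) auto
  then show si: "set_integrable lborel S f"
    unfolding set_integrable_def by (subst (asm) integrable_completion) auto
  show "(LBINT x:S. f x) = I"
    using set_borel_integral_eq_integral(2)[OF si] assms(3) by (simp add: integral_unique)
qed

section \<open>Generalized trigonometric functions\<close>

lemma arcsin_pq_has_integral:
  assumes "1 < p" "0 < q"
  shows "((\<lambda>t. (1 - t powr q) powr (- 1 / p)) has_integral Beta (1 / q) (1 / conj_exp p) / q) {0..1}"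
proof -
  have e: "1 / conj_exp p - 1 = - 1 / p" "0 < 1 / conj_exp p"
    using assms by (auto simp: conj_exp_def field_simps)
  have "((\<lambda>t. t powr (q * (1 / q) - 1) * (1 - t powr q) powr (1 / conj_exp p - 1))
      has_integral Beta (1 / q) (1 / conj_exp p) / q) {0<..<1}"
    using assms e(2) by (intro Beta_powr_substitution) auto
  then have "((\<lambda>t. (1 - t powr q) powr (- 1 / p)) has_integral Beta (1 / q) (1 / conj_exp p) / q) {0<..<1}"
    by (rule has_integral_eq[rotated]) (use assms e in auto)
  then show ?thesis by (simp add: has_integral_Icc_iff_Ioo)
qed

lemma arcsin_pq_eq_integral:
  assumes "1 < p" "0 < q" "x \<le> 1"
  shows "arcsin_pq p q x = integral {0..x} (\<lambda>t. (1 - t powr q) powr (- 1 / p))"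
proof -
  have "set_integrable lborel {0..1} (\<lambda>t. (1 - t powr q) powr (- 1 / p))"
    using assms by (intro nonneg_has_integral_imp_set_integrable(1)[OF _ _ arcsin_pq_has_integral]) auto
  then have "set_integrable lborel {0..x} (\<lambda>t. (1 - t powr q) powr (- 1 / p))"
    by (rule set_integrable_subset) (use assms in auto)
  then show ?thesis
    by (simp add: arcsin_pq_def set_borel_integral_eq_integral(2))
qed

lemma arcsin_pq_0: "arcsin_pq p q 0 = 0"
proof -
  have "AE t in lborel. indicator {0} t *\<^sub>R (1 - t powr q) powr (- 1 / p) = 0"
    using AE_lborel_singleton[of "0::real"] by eventually_elim auto
  then show ?thesis
    unfolding arcsin_pq_def set_lebesgue_integral_def by (simp add: integral_eq_zero_AE)
qed

lemma pi_pq_eq_Beta: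
  assumes "1 < p" "0 < q"
  shows "pi_pq p q = 2 / q * Beta (1 / q) (1 / conj_exp p)"
  using arcsin_pq_has_integral[OF assms] arcsin_pq_eq_integral[OF assms, of 1]
  by (simp add: pi_pq_def integral_unique)

lemma continuous_on_arcsin_pq:
  assumes "1 < p" "0 < q"
  shows "continuous_on {0..1} (arcsin_pq p q)"
proof -
  have "continuous_on {0..1} (\<lambda>x. integral {0..x} (\<lambda>t. (1 - t powr q) powr (- 1 / p)))"
    using arcsin_pq_has_integral[OF assms] by (intro indefinite_integral_continuous_1) auto
  then show ?thesis
    by (subst continuous_on_cong[OF refl arcsin_pq_eq_integral]) (use assms in auto)
qed

lemma arcsin_pq_derivative:
  assumes "1 < p" "0 < q" "0 < x" "x < 1"
  shows "(arcsin_pq p q has_real_derivative (1 - x powr q) powr (- 1 / p)) (at x)"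
proof -
  define y where "y = (x + 1) / 2"
  have y: "x < y" "y < 1" "0 < y" using assms by (auto simp: y_def)
  have "t powr q < 1" if "0 \<le> t" "t \<le> y" for t
    using that y assms by (intro powr_less_one') auto
  then have "continuous_on {0..y} (\<lambda>t. (1 - t powr q) powr (- 1 / p))"
    using assms by (force intro!: continuous_intros continuous_on_powr')
  then have "((\<lambda>x. integral {0..x} (\<lambda>t. (1 - t powr q) powr (- 1 / p)))
      has_real_derivative (1 - x powr q) powr (- 1 / p)) (at x within {0..y})"
    using assms y by (intro integral_has_real_derivative) auto
  then have "((\<lambda>x. integral {0..x} (\<lambda>t. (1 - t powr q) powr (- 1 / p)))
      has_real_derivative (1 - x powr q) powr (- 1 / p)) (at x)"
    using assms y by (simp add: at_within_Icc_at)
  then show ?thesis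
  proof (rule has_field_derivative_transform_within_open)
    show "open {0<..<1::real}" "x \<in> {0<..<1}" using assms by auto
    show "integral {0..x} (\<lambda>t. (1 - t powr q) powr (- 1 / p)) = arcsin_pq p q x" if "x \<in> {0<..<1}" for x
      using arcsin_pq_eq_integral[of p q x] assms that by simp
  qed
qed

lemma arcsin_pq_strict_mono:
  assumes "1 < p" "0 < q" "0 \<le> x" "x < y" "y \<le> 1"
  shows "arcsin_pq p q x < arcsin_pq p q y"
proof (rule DERIV_pos_imp_increasing_open[OF \<open>x < y\<close>])
  fix z assume z: "x < z" "z < y"
  then have "z powr q < 1" using assms by (intro powr_less_one') auto
  then show "\<exists>d. (arcsin_pq p q has_real_derivative d) (at z) \<and> 0 < d"
    using arcsin_pq_derivative[of p q z] assms z by force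
next
  show "continuous_on {x..y} (arcsin_pq p q)"
    using continuous_on_arcsin_pq[OF assms(1,2)] by (rule continuous_on_subset) (use assms in auto)
qed

lemma pi_pq_pos: "1 < p \<Longrightarrow> 0 < q \<Longrightarrow> 0 < pi_pq p q"
  using arcsin_pq_strict_mono[of p q 0 1] by (simp add: pi_pq_def arcsin_pq_0)

lemma inj_on_arcsin_pq: "1 < p \<Longrightarrow> 0 < q \<Longrightarrow> inj_on (arcsin_pq p q) {0..1}"
  by (rule linorder_inj_onI) (use arcsin_pq_strict_mono in fastforce)+

lemma arcsin_pq_image:
  assumes "1 < p" "0 < q"
  shows "arcsin_pq p q ` {0..1} = {0..pi_pq p q / 2}"
proof
  show "arcsin_pq p q ` {0..1} \<subseteq> {0..pi_pq p q / 2}"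
  proof clarsimp
    fix x :: real assume "0 \<le> x" "x \<le> 1"
    then show "0 \<le> arcsin_pq p q x \<and> arcsin_pq p q x * 2 \<le> pi_pq p q"
      using arcsin_pq_strict_mono[of p q 0 x] arcsin_pq_strict_mono[of p q x 1] assms
      by (cases "x = 0"; cases "x = 1") (auto simp: arcsin_pq_0 pi_pq_def)
  qed
  show "{0..pi_pq p q / 2} \<subseteq> arcsin_pq p q ` {0..1}"
  proof
    fix y assume "y \<in> {0..pi_pq p q / 2}"
    then obtain x where "0 \<le> x" "x \<le> 1" "arcsin_pq p q x = y"
      using IVT'[of "arcsin_pq p q" 0 y 1] continuous_on_arcsin_pq[OF assms]
      by (auto simp: arcsin_pq_0 pi_pq_def)
    then show "y \<in> arcsin_pq p q ` {0..1}" by auto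
  qed
qed

text \<open>The reflection at \<open>\<pi>\<^sub>p\<^sub>,\<^sub>q / 2\<close> written as a minimum, so that continuity across the middle is inherited
from the inverse function.\<close>

lemma sin_pq_eq: "sin_pq p q x = inv_into {0..1} (arcsin_pq p q) (min x (pi_pq p q - x))"
proof -
  have "(if x \<le> pi_pq p q / 2 then x else pi_pq p q - x) = min x (pi_pq p q - x)"
    by (simp add: min_def)
  then show ?thesis unfolding sin_pq_def by presburger
qed

lemma sin_pq_reflect: "sin_pq p q (pi_pq p q - x) = sin_pq p q x"
  by (simp add: sin_pq_eq min.commute)

lemma sin_pq_range:
  assumes "1 < p" "0 < q" "0 \<le> x" "x \<le> pi_pq p q"
  shows "0 \<le> sin_pq p q x" "sin_pq p q x \<le> 1"
proof -
  have "min x (pi_pq p q - x) \<in> arcsin_pq p q ` {0..1}"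
    unfolding arcsin_pq_image[OF assms(1,2)] using assms by (auto simp: min_def)
  then have "sin_pq p q x \<in> {0..1}" unfolding sin_pq_eq by (rule inv_into_into)
  then show "0 \<le> sin_pq p q x" "sin_pq p q x \<le> 1" by auto
qed

lemma arcsin_sin_pq:
  assumes "1 < p" "0 < q" "0 \<le> x" "x \<le> pi_pq p q / 2"
  shows "arcsin_pq p q (sin_pq p q x) = x"
proof -
  have "x \<in> arcsin_pq p q ` {0..1}"
    unfolding arcsin_pq_image[OF assms(1,2)] using assms by auto
  then show ?thesis using assms by (simp add: sin_pq_def f_inv_into_f)
qed

lemma sin_arcsin_pq:
  assumes "1 < p" "0 < q" "0 \<le> x" "x \<le> 1"
  shows "sin_pq p q (arcsin_pq p q x) = x"
proof -
  have "arcsin_pq p q x \<in> {0..pi_pq p q / 2}"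
    using arcsin_pq_image[OF assms(1,2)] assms by auto
  then show ?thesis
    using inv_into_f_f[OF inj_on_arcsin_pq[OF assms(1,2)]] assms by (simp add: sin_pq_def)
qed

lemma sin_pq_0: "1 < p \<Longrightarrow> 0 < q \<Longrightarrow> sin_pq p q 0 = 0"
  using sin_arcsin_pq[of p q 0] by (simp add: arcsin_pq_0)

lemma sin_pq_pi: "1 < p \<Longrightarrow> 0 < q \<Longrightarrow> sin_pq p q (pi_pq p q) = 0"
  using sin_pq_reflect[of p q 0] by (simp add: sin_pq_0)

lemma sin_pq_pi_half: "1 < p \<Longrightarrow> 0 < q \<Longrightarrow> sin_pq p q (pi_pq p q / 2) = 1"
  using sin_arcsin_pq[of p q 1] by (simp add: pi_pq_def)

lemma continuous_on_sin_pq: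
  assumes "1 < p" "0 < q"
  shows "continuous_on {0..pi_pq p q} (sin_pq p q)"
proof -
  have "continuous_on (arcsin_pq p q ` {0..1}) (inv_into {0..1} (arcsin_pq p q))"
    using continuous_on_arcsin_pq[OF assms] inj_on_arcsin_pq[OF assms]
    by (intro continuous_on_inv) auto
  then have "continuous_on {0..pi_pq p q} (\<lambda>x. inv_into {0..1} (arcsin_pq p q) (min x (pi_pq p q - x)))"
  proof (rule continuous_on_compose2)
    show "(\<lambda>x. min x (pi_pq p q - x)) ` {0..pi_pq p q} \<subseteq> arcsin_pq p q ` {0..1}"
      by (auto simp: arcsin_pq_image[OF assms] min_def)
  qed (intro continuous_intros)
  then show ?thesis unfolding sin_pq_eq[abs_def] .
qed

lemma sin_pq_interior:
  assumes "1 < p" "0 < q" "0 < x" "x < pi_pq p q / 2"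
  shows "0 < sin_pq p q x" "sin_pq p q x < 1"
proof -
  have "arcsin_pq p q (sin_pq p q x) = x"
    using assms by (intro arcsin_sin_pq) auto
  then have "sin_pq p q x \<noteq> 0" "sin_pq p q x \<noteq> 1"
    using assms by (auto simp: arcsin_pq_0 pi_pq_def)
  then show "0 < sin_pq p q x" "sin_pq p q x < 1"
    using sin_pq_range[of p q x] assms by force+
qed

lemma sin_pq_derivative_left:
  assumes "1 < p" "0 < q" "0 < x" "x < pi_pq p q / 2"
  shows "(sin_pq p q has_real_derivative (1 - sin_pq p q x powr q) powr (1 / p)) (at x)"
proof -
  have s: "0 < sin_pq p q x" "sin_pq p q x < 1"
    using sin_pq_interior[OF assms] .
  then have "sin_pq p q x powr q < 1" using assms by (intro powr_less_one') auto
  moreover have "isCont (sin_pq p q) x"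
    using continuous_on_sin_pq[OF assms(1,2)] assms
    by (intro continuous_on_interior[of "{0..pi_pq p q}"]) auto
  ultimately have "(sin_pq p q has_real_derivative inverse ((1 - sin_pq p q x powr q) powr (- 1 / p))) (at x)"
    using arcsin_sin_pq[OF assms(1,2)] assms s
    by (intro DERIV_inverse_function[OF arcsin_pq_derivative, of _ _ "sin_pq p q" x 0 "pi_pq p q / 2"]) auto
  then show ?thesis by (simp add: powr_minus[symmetric])
qed

lemma sin_pq_derivative_right:
  assumes "1 < p" "0 < q" "pi_pq p q / 2 < x" "x < pi_pq p q"
  shows "(sin_pq p q has_real_derivative - ((1 - sin_pq p q x powr q) powr (1 / p))) (at x)"
proof -
  have "((\<lambda>x. sin_pq p q (pi_pq p q - x)) has_real_derivative
      (1 - sin_pq p q (pi_pq p q - x) powr q) powr (1 / p) * (- 1)) (at x)"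
    by (rule DERIV_chain2[OF sin_pq_derivative_left]) (use assms in \<open>auto intro!: derivative_eq_intros\<close>)
  then show ?thesis by (simp add: sin_pq_reflect)
qed

text \<open>Substituting \<open>x = arcsin\<^sub>p t\<close> turns the integrand into \<open>t\<^bsup>-1/q\<^esup> (1 - t\<^sup>p)\<^bsup>-1/p\<^esup>\<close>.\<close>

lemma sin_p_integral_eq_Beta:
  assumes "1 < p" "1 < q"
  shows "sin_p_integral p q = Beta (1 / (p * conj_exp q)) (1 / conj_exp p) / p"
proof -
  let ?A = "arcsin_pq p p" and ?h = "\<lambda>x. 1 / sin_p p x powr (1 / q)"
  let ?g = "\<lambda>t. (1 - t powr p) powr (- 1 / p)"
  let ?B = "Beta (1 / (p * conj_exp q)) (1 / conj_exp p) / p"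
  have e: "p * (1 / (p * conj_exp q)) - 1 = - 1 / q" "1 / conj_exp p - 1 = - 1 / p"
    "0 < conj_exp q" "0 < conj_exp p"
    using assms by (auto simp: conj_exp_def field_simps)
  have I: "((\<lambda>t. t powr (- 1 / q) * ?g t) has_integral ?B) {0<..<1}"
    using Beta_powr_substitution[of p "1 / (p * conj_exp q)" "1 / conj_exp p"] assms e by simp
  have I': "((\<lambda>t. \<bar>?g t\<bar> * ?h (?A t)) has_integral ?B) {0<..<1}"
    by (rule has_integral_eq[OF _ I])
      (use assms in \<open>auto simp: sin_arcsin_pq powr_minus divide_inverse\<close>)
  have im: "?A ` {0<..<1} = {0<..<pi_p p / 2}"
  proof (intro set_eqI iffI)
    fix y assume "y \<in> ?A ` {0<..<1}"
    then show "y \<in> {0<..<pi_p p / 2}"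
      using arcsin_pq_strict_mono[of p p 0] arcsin_pq_strict_mono[of p p _ 1] assms
      by (auto simp: arcsin_pq_0 pi_pq_def)
  next
    fix y assume "y \<in> {0<..<pi_p p / 2}"
    then show "y \<in> ?A ` {0<..<1}"
      using arcsin_sin_pq[of p p y] sin_pq_interior[of p p y] assms
      by (intro image_eqI[of _ _ "sin_p p y"]) auto
  qed
  have "(\<lambda>t. \<bar>?g t\<bar> * ?h (?A t)) absolutely_integrable_on {0<..<1}"
    using I' by (intro nonnegative_absolutely_integrable_1) auto
  moreover have "(?A has_field_derivative ?g t) (at t within {0<..<1})" if "t \<in> {0<..<1}" for t
    using arcsin_pq_derivative[of p p t] assms that by (auto intro: DERIV_subset)
  moreover have "inj_on ?A {0<..<1}"
    using inj_on_arcsin_pq[of p p] assms by (auto intro: inj_on_subset)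
  ultimately have "?h absolutely_integrable_on {0<..<pi_p p / 2}" "integral {0<..<pi_p p / 2} ?h = ?B"
    using has_absolute_integral_change_of_variables_1'[of "{0<..<1}" ?A ?g ?h ?B] I' im
    by (auto simp: integral_unique)
  then have "(?h has_integral ?B) {0<..<pi_p p / 2}"
    by (simp add: has_integral_iff absolutely_integrable_on_def)
  then have H: "(?h has_integral ?B) {0..pi_p p / 2}"
    by (simp add: has_integral_Icc_iff_Ioo)
  \<comment> \<open>Outside \<open>[0, \<pi>\<^sub>p]\<close> the function \<open>sin\<^sub>p\<close> takes arbitrary values; clamping the argument
    makes the integrand measurable on the whole line.\<close>
  define h where "h x = ?h (max 0 (min (pi_p p) x))" for x
  have "continuous_on UNIV (\<lambda>x. sin_p p (max 0 (min (pi_p p) x)))"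
    using assms pi_pq_pos[of p p]
    by (intro continuous_on_compose2[OF continuous_on_sin_pq[of p p]]) (auto intro!: continuous_intros)
  then have "(\<lambda>x. sin_p p (max 0 (min (pi_p p) x))) \<in> borel_measurable borel"
    by (rule borel_measurable_continuous_onI)
  then have meas: "h \<in> borel_measurable borel"
    unfolding h_def by measurable
  have nn: "0 \<le> h x" for x
    by (simp add: h_def)
  have eq: "h x = ?h x" if "x \<in> {0..pi_p p / 2}" for x
    using that by (simp add: h_def)
  have "(h has_integral ?B) {0..pi_p p / 2}"
    by (rule has_integral_eq[OF _ H]) (simp add: eq)
  then have "(LBINT x:{0..pi_p p / 2}. h x) = ?B"
    using meas nn by (intro nonneg_has_integral_imp_set_integrable(2)) auto
  then show ?thesis
    unfolding sin_p_integral_def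
    by (subst (asm) set_lebesgue_integral_cong[of _ _ h ?h]) (auto simp: eq)
qed

section \<open>The sharp Sobolev inequality on an interval\<close>

lemma continuous_imp_integrable_leb_int:
  fixes f :: "real \<Rightarrow> real"
  assumes "continuous_on {0..L} f"
  shows "integrable (leb_int L) f" "(LINT x|leb_int L. f x) = integral {0..L} f"
proof -
  have "f absolutely_integrable_on {0<..<L}"
    using absolutely_integrable_continuous_real[OF assms]
    by (rule set_integrable_subset) auto
  then show i: "integrable (leb_int L) f"
    by (rule absolutely_integrable_imp_integrable) auto
  show "(LINT x|leb_int L. f x) = integral {0..L} f"
    using lebesgue_integral_eq_integral[OF i] by (simp add: integral_open_interval_real)
qed

lemma continuous_imp_Lp_space:
  assumes "continuous_on {0..L} f" "0 < p"
  shows "f \<in> Lp_space (leb_int L) p"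
proof -
  have "continuous_on {0..L} (\<lambda>x. \<bar>f x\<bar> powr p)"
    using assms by (intro continuous_on_powr' continuous_intros) auto
  then have "integrable (leb_int L) (\<lambda>x. \<bar>f x\<bar> powr p)"
    by (rule continuous_imp_integrable_leb_int(1))
  moreover have "f \<in> borel_measurable (leb_int L)"
    using continuous_imp_integrable_leb_int(1)[OF assms(1)] by (rule borel_measurable_integrable)
  ultimately show ?thesis
    by (simp add: Lp_space_def)
qed

text \<open>The number \<open>J = \<integral>\<^sub>0\<^sup>1 (1 - t\<^sup>r)\<^bsup>1/p*\<^esup> dt\<close>, as is shown in \<open>sobolev_peak_has_integral\<close>.\<close>

definition sobolev_peak :: "real \<Rightarrow> real \<Rightarrow> real" where
  "sobolev_peak p r = Beta (1 / r) (1 / conj_exp p + 1) / r"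

text \<open>The denominator is the maximum of \<open>X\<^bsup>p/r\<^esup> (L - X)\<^bsup>p-1\<^esup>\<close> over \<open>0 \<le> X \<le> L\<close>, which is attained at
\<open>X = L p\<^sup>* / (p\<^sup>* + r)\<close>.\<close>

definition sobolev_const :: "real \<Rightarrow> real \<Rightarrow> real \<Rightarrow> real" where
  "sobolev_const p r L = (2 * sobolev_peak p r) powr p /
     ((L * conj_exp p / (conj_exp p + r)) powr (p / r) * (L * r / (conj_exp p + r)) powr (p - 1))"

lemma conj_exp_bounds:
  assumes "1 < p" shows "1 < conj_exp p" "1 / p + 1 / conj_exp p = 1" "0 < conj_exp p"
  using assms by (auto simp: conj_exp_def field_simps)

lemma sobolev_peak_has_integral:
  assumes "1 < p" "0 < r"
  shows "((\<lambda>t. (1 - t powr r) powr (1 / conj_exp p)) has_integral sobolev_peak p r) {0..1}"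
proof -
  have "0 < 1 / conj_exp p + 1" using conj_exp_bounds[OF assms(1)] by (auto simp: add_pos_pos)
  then have "((\<lambda>t. t powr (r * (1 / r) - 1) * (1 - t powr r) powr (1 / conj_exp p + 1 - 1))
      has_integral sobolev_peak p r) {0<..<1}"
    unfolding sobolev_peak_def using assms by (intro Beta_powr_substitution) auto
  then have "((\<lambda>t. (1 - t powr r) powr (1 / conj_exp p)) has_integral sobolev_peak p r) {0<..<1}"
    by (rule has_integral_eq[rotated]) (use assms in auto)
  then show ?thesis by (simp add: has_integral_Icc_iff_Ioo)
qed

lemma sobolev_peak_pos:
  assumes "1 < p" "0 < r" shows "0 < sobolev_peak p r"
proof -
  have "0 < 1 / conj_exp p + 1" using conj_exp_bounds[OF assms(1)] by (auto simp: add_pos_pos)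
  then show ?thesis
    unfolding sobolev_peak_def Beta_def using assms
    by (intro divide_pos_pos mult_pos_pos Gamma_real_pos) (auto intro: add_pos_pos)
qed

text \<open>Add \<open>ln s \<le> s - 1\<close> for the two quotients of the factors by their values at the claimed maximum point, with weights
\<open>\<alpha>\<close> and \<open>\<beta>\<close>; the right-hand sides cancel.\<close>

lemma weighted_AM_GM_le:
  fixes x L \<alpha> \<beta> :: real
  assumes "0 \<le> x" "x \<le> L" "0 < \<alpha>" "0 < \<beta>" "0 < L"
  shows "x powr \<alpha> * (L - x) powr \<beta>
    \<le> (L * \<alpha> / (\<alpha> + \<beta>)) powr \<alpha> * (L * \<beta> / (\<alpha> + \<beta>)) powr \<beta>"
proof (cases "x = 0 \<or> x = L")
  case False
  then have x: "0 < x" "x < L" using assms by auto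
  define a b where ab: "a = L * \<alpha> / (\<alpha> + \<beta>)" "b = L * \<beta> / (\<alpha> + \<beta>)"
  have pos: "0 < a" "0 < b" using assms by (auto simp: ab)
  have "0 < x / a" "0 < (L - x) / b"
    by (rule divide_pos_pos, use pos x in simp, fact pos)+
  then have "ln (x / a) \<le> x / a - 1" "ln ((L - x) / b) \<le> (L - x) / b - 1"
    by (blast intro: ln_le_minus_one)+
  then have "\<alpha> * ln (x / a) + \<beta> * ln ((L - x) / b) \<le> \<alpha> * (x / a - 1) + \<beta> * ((L - x) / b - 1)"
    using assms by (intro add_mono mult_left_mono) auto
  also have "\<dots> = 0"
    using assms by (simp add: ab field_simps)
  finally have "\<alpha> * ln x + \<beta> * ln (L - x) \<le> \<alpha> * ln a + \<beta> * ln b"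
    using pos x by (simp add: ln_div algebra_simps)
  then have "exp (\<alpha> * ln x + \<beta> * ln (L - x)) \<le> exp (\<alpha> * ln a + \<beta> * ln b)"
    by simp
  then show ?thesis
    using pos x by (simp add: powr_def exp_add flip: ab)
qed (use assms in auto)

text \<open>Let \<open>G\<close> be an antiderivative of \<open>k(y) = (1 - |y|\<^sup>r)\<^bsup>1/p*\<^esup>\<close>. The function \<open>G(\<phi> / M)\<close> increases by
\<open>G(1) - G(0) = J\<close> on \<open>[0,x\<^sub>0]\<close> and decreases by the same amount on \<open>[x\<^sub>0,L]\<close>, and its derivative
is \<open>k(\<phi> / M) \<phi>' / M\<close>.\<close>

lemma sobolev_peak_le:
  assumes p: "1 < p" and r: "0 < r" and L: "0 < L" and x0: "x0 \<in> {0..L}"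
    and der: "\<And>x. (\<phi> has_real_derivative \<phi>' x) (at x)" and cont: "continuous_on UNIV \<phi>'"
    and bdry: "\<phi> 0 = 0" "\<phi> L = 0" and M: "0 < M" "\<phi> x0 = M" "\<And>x. x \<in> {0..L} \<Longrightarrow> \<bar>\<phi> x\<bar> \<le> M"
  shows "2 * sobolev_peak p r * M
    \<le> (LINT x|leb_int L. \<bar>\<phi>' x * (1 - (\<bar>\<phi> x\<bar> / M) powr r) powr (1 / conj_exp p)\<bar>)"
proof -
  define k where "k y = (max 0 (1 - \<bar>y\<bar> powr r)) powr (1 / conj_exp p)" for y :: real
  \<comment> \<open>The base point \<open>-2\<close> makes every point of \<open>[-1,1]\<close> interior, so that \<open>G\<close> has two-sided derivatives there.\<close>
  define G where "G y = integral {-2..y} k" for y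
  have cpos: "0 < 1 / conj_exp p" using conj_exp_bounds[OF p] by simp
  have cphi: "continuous_on S \<phi>" for S
    using der DERIV_continuous_on by (metis has_field_derivative_at_within)
  have cphi': "continuous_on S \<phi>'" for S
    using cont continuous_on_subset by blast
  have ck: "continuous_on S k" for S
    unfolding k_def using cpos r by (intro continuous_on_powr' continuous_intros) auto
  have G': "(G has_real_derivative k y) (at y)" if "\<bar>y\<bar> \<le> 1" for y
  proof -
    have "(G has_real_derivative k y) (at y within {-2..2})"
      unfolding G_def using that ck by (intro integral_has_real_derivative) auto
    moreover have "at y within {-2..2} = at y"
      using that by (intro at_within_Icc_at) auto
    ultimately show ?thesis by simp
  qed
  have Gint: "G 1 - G 0 = sobolev_peak p r"
  proof -
    have "(k has_integral sobolev_peak p r) {0..1}"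
    proof (rule has_integral_eq[OF _ sobolev_peak_has_integral[OF p r]])
      fix t :: real assume t: "t \<in> {0..1}"
      then have "t powr r \<le> 1" using r by (intro powr_le1) auto
      then show "(1 - t powr r) powr (1 / conj_exp p) = k t"
        using t by (simp add: k_def)
    qed
    moreover have "(k has_integral (G 1 - G 0)) {0..1}"
      by (rule fundamental_theorem_of_calculus)
        (auto intro!: DERIV_subset[OF G'] simp flip: has_real_derivative_iff_has_vector_derivative)
    ultimately show ?thesis by (metis has_integral_unique)
  qed
  define h where "h x = k (\<phi> x / M) * (\<phi>' x / M)" for x
  have FTC: "(h has_integral (G (\<phi> b / M) - G (\<phi> a / M))) {a..b}" if "0 \<le> a" "a \<le> b" "b \<le> L" for a b
  proof (rule fundamental_theorem_of_calculus[OF \<open>a \<le> b\<close>])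
    fix x assume x: "x \<in> {a..b}"
    have "((\<lambda>x. G (\<phi> x / M)) has_real_derivative k (\<phi> x / M) * (\<phi>' x / M)) (at x)"
    proof (rule DERIV_chain2[OF G'])
      show "\<bar>\<phi> x / M\<bar> \<le> 1" using M(1) M(3)[of x] x that by simp
      show "((\<lambda>x. \<phi> x / M) has_real_derivative \<phi>' x / M) (at x)"
        using M(1) by (intro DERIV_cdivide der)
    qed
    then show "((\<lambda>x. G (\<phi> x / M)) has_vector_derivative h x) (at x within {a..b})"
      unfolding h_def has_real_derivative_iff_has_vector_derivative[symmetric] by (rule DERIV_subset) simp
  qed
  have ch: "continuous_on {a..b} (\<lambda>x. \<bar>h x\<bar>)" for a b
    unfolding h_def using M(1) cphi cphi'
    by (intro continuous_intros continuous_on_compose2[OF ck[of UNIV]]) auto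
  have absh: "(\<lambda>x. \<bar>h x\<bar>) integrable_on {a..b}" for a b
    using ch by (rule integrable_continuous_real)
  have "(h has_integral sobolev_peak p r) {0..x0}" "(h has_integral - sobolev_peak p r) {x0..L}"
    using FTC[of 0 x0] FTC[of x0 L] x0 M(1,2) bdry unfolding Gint[symmetric] by auto
  then have "\<bar>sobolev_peak p r\<bar> \<le> integral {0..x0} (\<lambda>x. \<bar>h x\<bar>)"
    "\<bar>- sobolev_peak p r\<bar> \<le> integral {x0..L} (\<lambda>x. \<bar>h x\<bar>)"
    using integral_norm_bound_integral[of h "{0..x0}" "\<lambda>x. \<bar>h x\<bar>"]
      integral_norm_bound_integral[of h "{x0..L}" "\<lambda>x. \<bar>h x\<bar>"] absh
    by (auto simp: has_integral_iff)
  then have "2 * sobolev_peak p r \<le> integral {0..L} (\<lambda>x. \<bar>h x\<bar>)"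
    using Henstock_Kurzweil_Integration.integral_combine[of 0 x0 L "\<lambda>x. \<bar>h x\<bar>"] x0 absh by auto
  also have "\<dots> = integral {0..L} (\<lambda>x. \<bar>\<phi>' x * (1 - (\<bar>\<phi> x\<bar> / M) powr r) powr (1 / conj_exp p)\<bar> / M)"
  proof (rule Henstock_Kurzweil_Integration.integral_cong)
    fix x assume x: "x \<in> {0..L}"
    have "(\<bar>\<phi> x\<bar> / M) powr r \<le> 1" using M(1) M(3)[OF x] r by (intro powr_le1) auto
    then show "\<bar>h x\<bar> = \<bar>\<phi>' x * (1 - (\<bar>\<phi> x\<bar> / M) powr r) powr (1 / conj_exp p)\<bar> / M"
      using M(1) by (simp add: h_def k_def abs_mult)
  qed
  also have "\<dots> = integral {0..L} (\<lambda>x. \<bar>\<phi>' x * (1 - (\<bar>\<phi> x\<bar> / M) powr r) powr (1 / conj_exp p)\<bar>) / M"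
    by simp
  also have "integral {0..L} (\<lambda>x. \<bar>\<phi>' x * (1 - (\<bar>\<phi> x\<bar> / M) powr r) powr (1 / conj_exp p)\<bar>)
      = (LINT x|leb_int L. \<bar>\<phi>' x * (1 - (\<bar>\<phi> x\<bar> / M) powr r) powr (1 / conj_exp p)\<bar>)"
  proof (rule continuous_imp_integrable_leb_int(2)[symmetric])
    have "(\<bar>\<phi> x\<bar> / M) powr r \<le> 1" if "x \<in> {0..L}" for x
      using M(1) M(3)[OF that] r by (intro powr_le1) auto
    then show "continuous_on {0..L} (\<lambda>x. \<bar>\<phi>' x * (1 - (\<bar>\<phi> x\<bar> / M) powr r) powr (1 / conj_exp p)\<bar>)"
      using M(1) cpos r cphi cphi' by (intro continuous_intros continuous_on_powr') auto
  qed
  finally show ?thesis using M(1) by (simp add: field_simps)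
qed

text \<open>Hoelder's inequality separates the derivative from the weight in \<open>sobolev_peak_le\<close>. The weight has
\<open>p\<^sup>*\<close>-norm \<open>(L - X)\<^bsup>1/p*\<^esup>\<close>, where \<open>X\<close> is the integral of \<open>(|\<phi>| / M)\<^sup>r\<close>, and the unknown maximum
\<open>M\<close> is eliminated by maximizing over \<open>X\<close>.\<close>

theorem sharp_Sobolev_inequality:
  assumes p: "1 < p" and r: "0 < r" and L: "0 < L"
    and der: "\<And>x. (\<phi> has_real_derivative \<phi>' x) (at x)" and cont: "continuous_on UNIV \<phi>'"
    and bdry: "\<phi> 0 = 0" "\<phi> L = 0"
  shows "sobolev_const p r L * (LINT x|leb_int L. \<bar>\<phi> x\<bar> powr r) powr (p / r)
    \<le> (LINT x|leb_int L. \<bar>\<phi>' x\<bar> powr p)"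
proof -
  let ?A = "LINT x|leb_int L. \<bar>\<phi>' x\<bar> powr p" and ?I = "LINT x|leb_int L. \<bar>\<phi> x\<bar> powr r"
  let ?q = "conj_exp p" and ?J = "sobolev_peak p r"
  have cphi: "continuous_on S \<phi>" for S
    using der DERIV_continuous_on by (metis has_field_derivative_at_within)
  have cphi': "continuous_on S \<phi>'" for S
    using cont continuous_on_subset by blast
  have cabs: "continuous_on {0..L} (\<lambda>x. \<bar>\<phi> x\<bar>)" using cphi by (intro continuous_intros)
  obtain x0 where x0: "x0 \<in> {0..L}" "\<And>x. x \<in> {0..L} \<Longrightarrow> \<bar>\<phi> x\<bar> \<le> \<bar>\<phi> x0\<bar>"
    using continuous_attains_sup[OF _ _ cabs] L by auto
  define M where "M = \<bar>\<phi> x0\<bar>"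
  have A: "0 \<le> ?A" by (intro Bochner_Integration.integral_nonneg) auto
  show ?thesis
  proof (cases "M = 0")
    case True
    then have "\<phi> x = 0" if "x \<in> {0..L}" for x using x0(2)[OF that] by (simp add: M_def)
    then have "?I = 0" by (intro integral_eq_zero_AE AE_I2) auto
    then show ?thesis using A by simp
  next
    case False
    then have M: "0 < M" "\<And>x. x \<in> {0..L} \<Longrightarrow> \<bar>\<phi> x\<bar> \<le> M" using x0 by (auto simp: M_def)
    let ?k = "\<lambda>x. (1 - (\<bar>\<phi> x\<bar> / M) powr r) powr (1 / ?q)"
    have le1: "(\<bar>\<phi> x\<bar> / M) powr r \<le> 1" if "x \<in> {0..L}" for x
      using M(1) M(2)[OF that] r by (intro powr_le1) auto
    have ck: "continuous_on {0..L} ?k"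
      using M(1) conj_exp_bounds[OF p] r cphi le1 by (intro continuous_intros continuous_on_powr') auto
    have cr: "continuous_on {0..L} (\<lambda>x. \<bar>\<phi> x\<bar> powr r)"
      using r cphi by (intro continuous_intros continuous_on_powr') auto
    \<comment> \<open>If the extreme value is negative, argue with \<open>- \<phi>\<close>.\<close>
    have peak: "2 * ?J * M \<le> (LINT x|leb_int L. \<bar>\<phi>' x * ?k x\<bar>)"
    proof (cases "0 \<le> \<phi> x0")
      case True
      then show ?thesis
        by (intro sobolev_peak_le[OF p r L x0(1) der cont bdry M(1) _ M(2)]) (simp add: M_def)
    next
      case False
      have "2 * ?J * M \<le> (LINT x|leb_int L. \<bar>- \<phi>' x * (1 - (\<bar>- \<phi> x\<bar> / M) powr r) powr (1 / ?q)\<bar>)"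
      proof (rule sobolev_peak_le[OF p r L x0(1)])
        show "((\<lambda>x. - \<phi> x) has_real_derivative - \<phi>' x) (at x)" for x
          by (intro DERIV_minus der)
        show "continuous_on UNIV (\<lambda>x. - \<phi>' x)"
          by (intro continuous_on_minus cphi')
      qed (use x0 M False bdry in \<open>auto simp: M_def\<close>)
      then show ?thesis by simp
    qed
    define X where "X = ?I / M powr r"
    have kint: "(LINT x|leb_int L. \<bar>?k x\<bar> powr ?q) = L - X"
    proof -
      have "(LINT x|leb_int L. \<bar>?k x\<bar> powr ?q) = (LINT x|leb_int L. 1 - \<bar>\<phi> x\<bar> powr r / M powr r)"
      proof (rule Bochner_Integration.integral_cong)
        fix x assume "x \<in> space (leb_int L)"
        then show "\<bar>?k x\<bar> powr ?q = 1 - \<bar>\<phi> x\<bar> powr r / M powr r"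
          using le1[of x] conj_exp_bounds[OF p] M(1) by (simp add: powr_powr powr_divide)
      qed simp
      also have "\<dots> = (LINT x|leb_int L. 1) - X"
        unfolding X_def using continuous_imp_integrable_leb_int(1)[OF cr] continuous_imp_integrable_leb_int(1)[of L "\<lambda>x. 1"]
        by (subst Bochner_Integration.integral_diff) auto
      also have "(LINT x|leb_int L. 1) = L"
        using continuous_imp_integrable_leb_int(2)[of L "\<lambda>x. 1"] L by simp
      finally show ?thesis .
    qed
    then have X: "0 \<le> X" "X \<le> L"
      using Bochner_Integration.integral_nonneg[of "leb_int L" "\<lambda>x. \<bar>?k x\<bar> powr ?q"]
      by (auto simp: X_def)
    have "2 * ?J * M \<le> Lp_norm (leb_int L) p \<phi>' * Lp_norm (leb_int L) ?q ?k"
      using peak Hoelder_inequality(2)[OF p conj_exp_bounds(1,2)[OF p]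
          continuous_imp_Lp_space[OF cphi', of p] continuous_imp_Lp_space[OF ck, of ?q]]
        p conj_exp_bounds[OF p] by linarith
    also have "\<dots> = ?A powr (1 / p) * (L - X) powr (1 / ?q)"
      unfolding Lp_norm_def kint ..
    finally have "(2 * ?J * M) powr p \<le> (?A powr (1 / p) * (L - X) powr (1 / ?q)) powr p"
      using p M sobolev_peak_pos[OF p r] by (intro powr_mono2) auto
    also have "\<dots> = ?A * (L - X) powr (p - 1)"
    proof -
      have "p / ?q = p - 1" using p by (simp add: conj_exp_def)
      then show ?thesis using A X p by (simp add: powr_mult powr_powr)
    qed
    finally have main: "(2 * ?J) powr p * M powr p \<le> ?A * (L - X) powr (p - 1)"
      using sobolev_peak_pos[OF p r] M by (simp add: powr_mult)
    have "?I = X * M powr r" using M by (simp add: X_def)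
    then have "?I powr (p / r) = X powr (p / r) * M powr p"
      using X M r by (simp add: powr_mult powr_powr)
    then have "(2 * ?J) powr p * ?I powr (p / r) = ((2 * ?J) powr p * M powr p) * X powr (p / r)"
      by simp
    also have "\<dots> \<le> ?A * (L - X) powr (p - 1) * X powr (p / r)"
      using main by (intro mult_right_mono) auto
    also have "\<dots> = ?A * (X powr (p / r) * (L - X) powr (p - 1))" by simp
    also have "\<dots> \<le> ?A * ((L * ?q / (?q + r)) powr (p / r) * (L * r / (?q + r)) powr (p - 1))"
    proof (rule mult_left_mono[OF _ A])
      have e: "L * (p / r) / (p / r + (p - 1)) = L * ?q / (?q + r)"
        "L * (p - 1) / (p / r + (p - 1)) = L * r / (?q + r)"
        using p r by (auto simp: conj_exp_def divide_simps) (auto simp: algebra_simps)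
      show "X powr (p / r) * (L - X) powr (p - 1)
          \<le> (L * ?q / (?q + r)) powr (p / r) * (L * r / (?q + r)) powr (p - 1)"
        using weighted_AM_GM_le[OF X, of "p / r" "p - 1"] p r L unfolding e by simp
    qed
    finally show ?thesis
      unfolding sobolev_const_def using p r L conj_exp_bounds[OF p]
      by (simp add: pos_divide_le_eq)
  qed
qed

lemma sobolev_const_pos:
  assumes "1 < p" "0 < r" "0 < L" shows "0 < sobolev_const p r L"
proof -
  have "0 < conj_exp p" "0 < conj_exp p + r" "0 < 2 * sobolev_peak p r"
    using conj_exp_bounds(3)[OF assms(1)] sobolev_peak_pos[OF assms(1,2)] assms(2) by linarith+
  then show ?thesis
    unfolding sobolev_const_def using assms by simp
qed

section \<open>Smooth functions and test functions\<close>

text \<open>The functions \<open>x\<^bsup>-k\<^esup> exp(-1/x)\<close> on \<open>x > 0\<close>, extended by zero. The powers are included because the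
derivatives of \<open>exp(-1/x)\<close> are linear combinations of these functions.\<close>

definition flat :: "nat \<Rightarrow> real \<Rightarrow> real" where
  "flat k x = (if 0 < x then (1 / x) ^ k * exp (- (1 / x)) else 0)"

lemma flat_tendsto_0: "(flat k \<longlongrightarrow> 0) (at 0)"
proof (rule filterlim_split_at)
  show "(flat k \<longlongrightarrow> 0) (at_left 0)" "(flat k \<longlongrightarrow> 0) (at_right 0)"
  proof -
    have neg_one_less: "- 1 < (0::real)" by simp
    have "\<forall>\<^sub>F x in at_left (0::real). 0 = flat k x"
      using eventually_at_left_real[of "-1" "0::real", OF neg_one_less] by eventually_elim (auto simp: flat_def)
    then show "(flat k \<longlongrightarrow> 0) (at_left 0)"
      by (rule Lim_transform_eventually[OF tendsto_const])
    have "((\<lambda>x::real. inverse x ^ k / exp (inverse x)) \<longlongrightarrow> 0) (at_right 0)"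
      by (rule filterlim_compose[OF tendsto_power_div_exp_0 filterlim_inverse_at_top_right])
    moreover have "\<forall>\<^sub>F x in at_right (0::real). inverse x ^ k / exp (inverse x) = flat k x"
      using eventually_at_right_real[of "0::real" 1, OF zero_less_one]
      by eventually_elim (auto simp: flat_def exp_minus inverse_eq_divide)
    ultimately show "(flat k \<longlongrightarrow> 0) (at_right 0)"
      by (rule Lim_transform_eventually)
  qed
qed

lemma flat_derivative:
  "(flat k has_real_derivative - real k * flat (k + 1) x + flat (k + 2) x) (at x)"
proof -
  consider "x < 0" | "x = 0" | "0 < x" by linarith
  then show ?thesis
  proof cases
    case 1
    have "((\<lambda>x. 0) has_real_derivative 0) (at x)" by simp
    then have "(flat k has_real_derivative 0) (at x)"
      by (rule has_field_derivative_transform_within_open[of _ _ _ "{..<0}"]) (use 1 in \<open>auto simp: flat_def\<close>)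
    then show ?thesis using 1 by (simp add: flat_def)
  next
    case 2
    have "((\<lambda>y. (flat k y - flat k 0) / (y - 0)) \<longlongrightarrow> 0) (at 0)"
      using flat_tendsto_0[of "k + 1"]
      by (rule Lim_transform_eventually) (auto simp: flat_def)
    then show ?thesis using 2 by (simp add: has_field_derivative_iff flat_def)
  next
    case 3
    have "((\<lambda>x. (1 / x) ^ k * exp (- (1 / x))) has_real_derivative
       (of_nat k * (1 / x) ^ (k - 1) * (- 1 / x\<^sup>2)) * exp (- (1 / x)) + (1 / x) ^ k * (exp (- (1 / x)) * (1 / x\<^sup>2))) (at x)"
      using 3 by (auto intro!: derivative_eq_intros simp: power2_eq_square)
    moreover have "(of_nat k * (1 / x) ^ (k - 1) * (- 1 / x\<^sup>2)) * exp (- (1 / x)) + (1 / x) ^ k * (exp (- (1 / x)) * (1 / x\<^sup>2))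
        = - real k * flat (k + 1) x + flat (k + 2) x"
      using 3 by (cases k) (auto simp: flat_def power2_eq_square field_simps)
    ultimately have "((\<lambda>x. (1 / x) ^ k * exp (- (1 / x))) has_real_derivative
       - real k * flat (k + 1) x + flat (k + 2) x) (at x)" by simp
    then show ?thesis
      by (rule has_field_derivative_transform_within_open[of _ _ _ "{0<..}"]) (use 3 in \<open>auto simp: flat_def\<close>)
  qed
qed

lemma flat_0_bounds: "0 \<le> flat 0 x" "flat 0 x \<le> 1"
  by (auto simp: flat_def)

text \<open>A class of infinitely differentiable functions. It is generated so that it is closed under derivatives,
which makes infinite differentiability a consequence of a single induction (\<open>smooth_derivative\<close>). The
clause for primitives provides the linear functions, and later the approximating test functions.\<close>

inductive smooth :: "(real \<Rightarrow> real) \<Rightarrow> bool" where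
  const: "smooth (\<lambda>x. c)"
| primitive: "(\<And>x. (F has_real_derivative f x) (at x)) \<Longrightarrow> smooth f \<Longrightarrow> smooth F"
| add: "smooth f \<Longrightarrow> smooth g \<Longrightarrow> smooth (\<lambda>x. f x + g x)"
| mult: "smooth f \<Longrightarrow> smooth g \<Longrightarrow> smooth (\<lambda>x. f x * g x)"
| flat: "smooth (\<lambda>x. flat k (a * x + b))"

lemmas smooth_intros = smooth.const smooth.add smooth.mult smooth.flat

lemma smooth_derivative:
  "smooth f \<Longrightarrow> \<exists>f'. (\<forall>x. (f has_real_derivative f' x) (at x)) \<and> smooth f'"
proof (induction rule: smooth.induct)
  case (const c)
  show ?case by (intro exI[of _ "\<lambda>x. 0"]) (auto intro: smooth.const)
next
  case (primitive F f)
  then show ?case by blast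
next
  case (add f g)
  then obtain f' g' where "\<And>x. (f has_real_derivative f' x) (at x)" "smooth f'"
    "\<And>x. (g has_real_derivative g' x) (at x)" "smooth g'" by blast
  then show ?case
    by (intro exI[of _ "\<lambda>x. f' x + g' x"]) (auto intro: smooth.add DERIV_add)
next
  case (mult f g)
  then obtain f' g' where "\<And>x. (f has_real_derivative f' x) (at x)" "smooth f'"
    "\<And>x. (g has_real_derivative g' x) (at x)" "smooth g'" by blast
  then show ?case using mult
    by (intro exI[of _ "\<lambda>x. f' x * g x + g' x * f x"]) (auto intro: smooth.add smooth.mult DERIV_mult)
next
  case (flat k a b)
  have "((\<lambda>x. flat k (a * x + b)) has_real_derivative
      (- real k * flat (k + 1) (a * x + b) + flat (k + 2) (a * x + b)) * a) (at x)" for x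
    by (rule DERIV_chain2[OF flat_derivative]) (auto intro!: derivative_eq_intros)
  moreover have "smooth (\<lambda>x. (- real k * flat (k + 1) (a * x + b) + flat (k + 2) (a * x + b)) * a)"
    by (intro smooth_intros)
  ultimately show ?case
    by (intro exI[of _ "\<lambda>x. (- real k * flat (k + 1) (a * x + b) + flat (k + 2) (a * x + b)) * a"]) auto
qed

lemma smooth_iterated_deriv: "smooth f \<Longrightarrow> smooth ((deriv ^^ n) f)"
proof (induction n)
  case (Suc n)
  then obtain f' where "\<And>x. ((deriv ^^ n) f has_real_derivative f' x) (at x)" "smooth f'"
    using smooth_derivative by blast
  then have "deriv ((deriv ^^ n) f) = f'" by (auto intro: DERIV_imp_deriv)
  then show ?case using \<open>smooth f'\<close> by simp
qed simp

lemma smooth_continuous_on: "smooth f \<Longrightarrow> continuous_on S f"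
  using smooth_derivative DERIV_continuous_on by (metis has_field_derivative_at_within)

lemma smooth_polynomial: "real_polynomial_function f \<Longrightarrow> smooth f"
proof (induction rule: real_polynomial_function.induct)
  case (linear f)
  then obtain c where "f = (\<lambda>x. x * c)"
    using real_bounded_linear by auto
  moreover have "((\<lambda>x. x * c) has_real_derivative c) (at x)" for x
    by (auto intro!: derivative_eq_intros)
  ultimately show ?case using smooth.primitive[of f "\<lambda>x. c"] smooth.const by auto
qed (auto intro: smooth_intros)

lemma test_functionsI:
  assumes "smooth \<phi>" "\<And>x. x \<notin> {c..d} \<Longrightarrow> \<phi> x = 0" "0 < c" "d < L"
  shows "\<phi> \<in> test_functions L"
proof -
  have sub: "closure {x. \<phi> x \<noteq> 0} \<subseteq> {c..d}"
  proof (rule closure_minimal)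
    show "{x. \<phi> x \<noteq> 0} \<subseteq> {c..d}" using assms(2) by blast
  qed simp
  then have "bounded (closure {x. \<phi> x \<noteq> 0})"
    by (rule bounded_subset[rotated]) simp
  then have "compact (closure {x. \<phi> x \<noteq> 0})"
    by (simp add: compact_eq_bounded_closed)
  moreover have "(deriv ^^ n) \<phi> field_differentiable at x" for n x
    using smooth_derivative[OF smooth_iterated_deriv[OF assms(1)]] field_differentiable_def by blast
  ultimately show ?thesis
    unfolding test_functions_def using sub assms(3,4) by force
qed

lemma test_function_properties:
  assumes "\<phi> \<in> test_functions L"
  shows "(\<phi> has_real_derivative deriv \<phi> x) (at x)" "continuous_on S (deriv \<phi>)" "continuous_on S \<phi>"
    and "\<phi> 0 = 0" "\<phi> L = 0"
proof -
  have d: "(deriv ^^ n) \<phi> field_differentiable at x" for n x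
    using assms by (auto simp: test_functions_def)
  show "(\<phi> has_real_derivative deriv \<phi> x) (at x)"
    using d[of 0 x] by (simp add: field_differentiable_derivI)
  have "\<phi> field_differentiable at x" "deriv \<phi> field_differentiable at x" for x
    using d[of 0 x] d[of 1 x] by auto
  then show "continuous_on S \<phi>" "continuous_on S (deriv \<phi>)"
    by (auto intro!: continuous_at_imp_continuous_on field_differentiable_imp_continuous_at)
  have "{x. \<phi> x \<noteq> 0} \<subseteq> {0<..<L}"
    using assms closure_subset[of "{x. \<phi> x \<noteq> 0}"] unfolding test_functions_def by blast
  then show "\<phi> 0 = 0" "\<phi> L = 0" by auto
qed

text \<open>For \<open>s \<ge> 0\<close> supported in \<open>[c,d]\<close>, with values in \<open>[0,1]\<close>. As the slope parameter \<open>s\<close> tends to infinity these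
functions converge to the indicator function of \<open>(c,d)\<close>, so they serve as cutoff functions.\<close>

definition bump :: "real \<Rightarrow> real \<Rightarrow> real \<Rightarrow> real \<Rightarrow> real" where
  "bump s c d x = flat 0 (s * (x - c)) * flat 0 (s * (d - x))"

lemma smooth_bump: "smooth (bump s c d)"
proof -
  have "smooth (\<lambda>x. flat 0 (s * x + - (s * c)) * flat 0 (- s * x + s * d))"
    by (intro smooth_intros)
  then show ?thesis by (simp add: bump_def[abs_def] algebra_simps)
qed

lemma bump_bounds: "0 \<le> bump s c d x" "bump s c d x \<le> 1"
  using flat_0_bounds by (auto simp: bump_def mult_le_one)

lemma bump_outside: "0 \<le> s \<Longrightarrow> x \<notin> {c<..<d} \<Longrightarrow> bump s c d x = 0"
  by (auto simp: bump_def flat_def zero_less_mult_iff)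

lemma flat_0_tendsto_1:
  assumes "filterlim f at_top F"
  shows "((\<lambda>n. flat 0 (f n)) \<longlongrightarrow> 1) F"
proof -
  have "((\<lambda>n. exp (- (inverse (f n)))) \<longlongrightarrow> exp (- 0)) F"
    by (intro tendsto_intros tendsto_inverse_0_at_top assms)
  moreover have "\<forall>\<^sub>F n in F. 0 < f n"
    using assms by (simp add: filterlim_at_top_dense)
  then have "\<forall>\<^sub>F n in F. exp (- (inverse (f n))) = flat 0 (f n)"
    by eventually_elim (auto simp: flat_def inverse_eq_divide)
  ultimately show ?thesis
    using Lim_transform_eventually by fastforce
qed

lemma bump_tendsto_indicator:
  "(\<lambda>n. bump (real n) c d x) \<longlonglongrightarrow> indicator {c<..<d} x"
proof (cases "x \<in> {c<..<d}")
  case True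
  have *: "filterlim (\<lambda>n. real n * y) at_top sequentially" if "0 < y" for y
    using filterlim_tendsto_pos_mult_at_top[OF tendsto_const that filterlim_real_sequentially]
    by (simp add: mult.commute)
  have "(\<lambda>n. bump (real n) c d x) \<longlonglongrightarrow> 1 * 1"
    unfolding bump_def using True by (intro tendsto_mult flat_0_tendsto_1 *) auto
  then show ?thesis using True by simp
qed (simp add: bump_outside)

section \<open>Weak derivatives\<close>

text \<open>Bumps approximate indicator functions, so \<open>h\<close> has integral zero over every interval \<open>[c,d]\<close> inside \<open>(0,L)\<close>.
By Lebesgue's differentiation theorem \<open>h(x)\<close> is, for almost every \<open>x\<close>, the limit of its averages over
\<open>[x,x+t]\<close>, all of which vanish.\<close>

lemma fundamental_lemma_of_variations:
  assumes h: "integrable (leb_int L) h"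
    and zero: "\<And>\<phi>. \<phi> \<in> test_functions L \<Longrightarrow> (LINT x|leb_int L. h x * \<phi> x) = 0"
  shows "AE x in leb_int L. h x = 0"
proof -
  have [measurable]: "h \<in> borel_measurable (leb_int L)" using h by simp
  have int0: "integral {c..d} h = 0" if cd: "0 < c" "d < L" for c d
  proof -
    have bm[measurable]: "bump (real n) c d \<in> borel_measurable (leb_int L)" for n
      using continuous_imp_integrable_leb_int(1)[OF smooth_continuous_on[OF smooth_bump]] by simp
    have ind[measurable]: "indicator {c<..<d} \<in> borel_measurable (leb_int L)"
      using cd by (intro borel_measurable_indicator) (auto simp: sets_restrict_space_iff)
    have "(\<lambda>n. LINT x|leb_int L. h x * bump (real n) c d x) \<longlonglongrightarrow> (LINT x|leb_int L. h x * indicator {c<..<d} x)"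
    proof (rule integral_dominated_convergence[where w = "\<lambda>x. \<bar>h x\<bar>"])
      show "AE x in leb_int L. (\<lambda>n. h x * bump (real n) c d x) \<longlonglongrightarrow> h x * indicator {c<..<d} x"
        by (intro AE_I2 tendsto_mult tendsto_const bump_tendsto_indicator)
      show "AE x in leb_int L. norm (h x * bump (real n) c d x) \<le> \<bar>h x\<bar>" for n
        using bump_bounds[of "real n" c d] by (intro AE_I2) (auto simp: abs_mult mult_left_le)
    qed (use h in \<open>measurable, auto\<close>)
    moreover have "(LINT x|leb_int L. h x * bump (real n) c d x) = 0" for n
      by (intro zero test_functionsI[OF smooth_bump _ cd] bump_outside) auto
    ultimately have "(LINT x|leb_int L. h x * indicator {c<..<d} x) = 0"
      by (simp add: LIMSEQ_const_iff)
    moreover have "integrable (leb_int L) (\<lambda>x. h x * indicator {c<..<d} x)"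
    proof (rule Bochner_Integration.integrable_bound[OF h])
      show "(\<lambda>x. h x * indicator {c<..<d} x) \<in> borel_measurable (leb_int L)" by measurable
    qed (auto simp: indicator_def)
    ultimately have "integral {0<..<L} (\<lambda>x. h x * indicator {c<..<d} x) = 0"
      by (simp add: lebesgue_integral_eq_integral)
    also have "(\<lambda>x. h x * indicator {c<..<d} x) = (\<lambda>x. if x \<in> {c<..<d} then h x else 0)"
      by (auto simp: indicator_def)
    finally have "integral ({0<..<L} \<inter> {c<..<d}) h = 0"
      by (simp only: integral_restrict_Int Int_commute)
    also have "{0<..<L} \<inter> {c<..<d} = {c<..<d}" using cd by auto
    finally show ?thesis by (simp add: integral_open_interval_real)
  qed
  define f where "f x = (if x \<in> {0<..<L} then h x else 0)" for x
  have "h integrable_on {0<..<L}"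
    using integrable_on_lebesgue_on[OF h] by simp
  moreover have "(\<lambda>x. \<bar>h x\<bar>) integrable_on {0<..<L}"
    using integrable_on_lebesgue_on[OF integrable_abs[OF h]] by simp
  ultimately have "h absolutely_integrable_on {0<..<L}"
    by (simp add: absolutely_integrable_on_def)
  then have "f absolutely_integrable_on UNIV"
    unfolding f_def by (subst absolutely_integrable_restrict_UNIV)
  then have "f absolutely_integrable_on cbox a b" for a b
    by (rule set_integrable_subset) auto
  then have "f integrable_on cbox a b" for a b
    by (simp add: absolutely_integrable_on_def)
  then obtain N where N: "negligible N" and
    lim: "\<And>x e. x \<notin> N \<Longrightarrow> 0 < e \<Longrightarrow>
      \<exists>d>0. \<forall>h. 0 < h \<and> h < d \<longrightarrow> norm (integral (cbox x (x + h *\<^sub>R One)) f /\<^sub>R h ^ DIM(real) - f x) < e"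
    using integrable_ccontinuous_explicit by blast
  have "h x = 0" if x: "x \<in> {0<..<L}" "x \<notin> N" for x
  proof (rule ccontr)
    assume "h x \<noteq> 0"
    then obtain d where d: "d > 0" "\<And>h. 0 < h \<Longrightarrow> h < d \<Longrightarrow>
        norm (integral (cbox x (x + h *\<^sub>R One)) f /\<^sub>R h ^ DIM(real) - f x) < \<bar>f x\<bar>"
      using lim[of x "\<bar>f x\<bar>"] x by (auto simp: f_def)
    define t where "t = min d (L - x) / 2"
    have t: "0 < t" "t < d" "x + t < L" using d(1) x by (auto simp: t_def min_def field_simps)
    have "integral {x..x + t} f = integral {x..x + t} h"
      using x t by (intro Henstock_Kurzweil_Integration.integral_cong) (auto simp: f_def)
    also have "\<dots> = 0" using x t by (intro int0) auto
    finally show False using d(2)[OF t(1,2)] by simp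
  qed
  then have "{x \<in> {0<..<L}. h x \<noteq> 0} \<subseteq> N" by auto
  then have "negligible {x \<in> {0<..<L}. h x \<noteq> 0}" using N negligible_subset by blast
  then have "{x \<in> {0<..<L}. h x \<noteq> 0} \<in> null_sets (leb_int L)"
    by (subst null_sets_restrict_space) (auto simp: negligible_iff_null_sets)
  then show ?thesis
    by (rule AE_I') auto
qed

text \<open>The definition of \<open>W1p0\<close> and that of a weak solution each speak of some weak derivative; this lemma identifies the two.\<close>

lemma weak_deriv_unique:
  assumes "1 < p" "g1 \<in> Lp_space (leb_int L) p" "g2 \<in> Lp_space (leb_int L) p"
    and "weak_deriv L u g1" "weak_deriv L u g2"
  shows "AE x in leb_int L. g1 x = g2 x"
proof -
  let ?M = "leb_int L"
  have q: "1 < p / (p - 1)" "1 / p + 1 / (p / (p - 1)) = 1" using assms(1) by (auto simp: field_simps)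
  have int: "integrable ?M (\<lambda>x. g x * \<phi> x)" if "g \<in> Lp_space ?M p" "continuous_on {0..L} \<phi>" for g \<phi>
    using q by (intro Hoelder_inequality(1)[OF assms(1) q] that continuous_imp_Lp_space) auto
  have int1: "integrable ?M g" if "g \<in> Lp_space ?M p" for g
    using int[OF that, of "\<lambda>x. 1"] by simp
  have "AE x in ?M. g1 x - g2 x = 0"
  proof (rule fundamental_lemma_of_variations)
    show "integrable ?M (\<lambda>x. g1 x - g2 x)" using int1 assms by simp
    fix \<phi> assume \<phi>: "\<phi> \<in> test_functions L"
    have "(LINT x|?M. g1 x * \<phi> x) = (LINT x|?M. g2 x * \<phi> x)"
      using assms(4,5) \<phi> unfolding weak_deriv_def by fastforce
    then show "(LINT x|?M. (g1 x - g2 x) * \<phi> x) = 0"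
      using int[OF assms(2) test_function_properties(3)[OF \<phi>]] int[OF assms(3) test_function_properties(3)[OF \<phi>]]
      by (simp add: left_diff_distrib)
  qed
  then show ?thesis by simp
qed

lemma Lp_norm_tendsto_0_bounded:
  assumes p: "0 < p" and L: "0 < L" and F: "\<And>n. continuous_on {0..L} (F n)" and f: "continuous_on {0..L} f"
    and lim: "\<And>x. x \<in> {0<..<L} \<Longrightarrow> (\<lambda>n. F n x) \<longlonglongrightarrow> f x"
    and bd: "\<And>n x. x \<in> {0<..<L} \<Longrightarrow> \<bar>F n x - f x\<bar> \<le> K"
  shows "(\<lambda>n. Lp_norm (leb_int L) p (\<lambda>x. F n x - f x)) \<longlonglongrightarrow> 0"
proof -
  let ?M = "leb_int L"
  have [measurable]: "F n \<in> borel_measurable ?M" "f \<in> borel_measurable ?M" for n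
    using continuous_imp_integrable_leb_int(1)[OF F] continuous_imp_integrable_leb_int(1)[OF f] by auto
  have m: "(\<lambda>x. \<bar>F n x - f x\<bar> powr p) \<in> borel_measurable ?M" for n
    by measurable
  have "(\<lambda>n. LINT x|?M. \<bar>F n x - f x\<bar> powr p) \<longlonglongrightarrow> (LINT x|?M. 0)"
  proof (rule integral_dominated_convergence[where w = "\<lambda>x. K powr p"])
    show "integrable ?M (\<lambda>x. K powr p)"
      by (intro continuous_imp_integrable_leb_int continuous_intros)
    show "AE x in ?M. (\<lambda>n. \<bar>F n x - f x\<bar> powr p) \<longlonglongrightarrow> 0"
    proof (rule AE_I2)
      fix x assume "x \<in> space ?M"
      then have "(\<lambda>n. F n x - f x) \<longlonglongrightarrow> 0"
        using lim[of x] by (simp add: LIM_zero_iff)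
      then show "(\<lambda>n. \<bar>F n x - f x\<bar> powr p) \<longlonglongrightarrow> 0"
        using tendsto_powr2[of "\<lambda>n. \<bar>F n x - f x\<bar>" 0 sequentially "\<lambda>_. p" p] p
        by (simp add: tendsto_rabs_zero)
    qed
    show "AE x in ?M. norm (\<bar>F n x - f x\<bar> powr p) \<le> K powr p" for n
      using bd p by (intro AE_I2) (auto intro!: powr_mono2)
  qed (use m in auto)
  then have "(\<lambda>n. (LINT x|?M. \<bar>F n x - f x\<bar> powr p) powr (1 / p)) \<longlonglongrightarrow> 0 powr (1 / p)"
    using p by (intro tendsto_powr2) (auto intro!: eventuallyI Bochner_Integration.integral_nonneg)
  then show ?thesis by (simp add: Lp_norm_def)
qed

text \<open>Integration by parts. Only the test function has to vanish at the end points, so this applies to the flux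
\<open>|u'|\<^bsup>p-2\<^esup> u'\<close> as well as to \<open>u\<close>.\<close>

lemma weak_derivI:
  assumes L: "0 < L" and u: "continuous_on {0..L} u" and v: "continuous_on {0..L} v"
    and fin: "finite S" and der: "\<And>x. x \<in> {0<..<L} - S \<Longrightarrow> (u has_real_derivative v x) (at x)"
  shows "weak_deriv L u v"
  unfolding weak_deriv_def
proof
  fix \<phi> assume \<phi>: "\<phi> \<in> test_functions L"
  note P = test_function_properties[OF \<phi>]
  have "((\<lambda>x. u x * deriv \<phi> x + v x * \<phi> x) has_integral u L * \<phi> L - u 0 * \<phi> 0) {0..L}"
  proof (rule fundamental_theorem_of_calculus_interior_strong[OF fin])
    show "((\<lambda>x. u x * \<phi> x) has_vector_derivative u x * deriv \<phi> x + v x * \<phi> x) (at x)"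
      if "x \<in> {0<..<L} - S" for x
      using DERIV_mult[OF der[OF that] P(1)[of x]]
      by (simp add: has_real_derivative_iff_has_vector_derivative[symmetric] algebra_simps)
  qed (use L u P(3) in \<open>auto intro!: continuous_intros\<close>)
  then have "integral {0..L} (\<lambda>x. u x * deriv \<phi> x + v x * \<phi> x) = 0"
    using P(4,5) by (simp add: integral_unique)
  moreover have c: "continuous_on {0..L} (\<lambda>x. u x * deriv \<phi> x)" "continuous_on {0..L} (\<lambda>x. v x * \<phi> x)"
    using u v P(2,3) by (auto intro!: continuous_intros)
  ultimately have "(LINT x|leb_int L. u x * deriv \<phi> x + v x * \<phi> x) = 0"
    by (subst continuous_imp_integrable_leb_int(2)) (auto intro!: continuous_on_add)
  then show "(LINT x|leb_int L. u x * deriv \<phi> x) = - (LINT x|leb_int L. v x * \<phi> x)"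
    using c continuous_imp_integrable_leb_int(1) by simp
qed

section \<open>Piecewise differentiable functions belong to the Sobolev space\<close>

lemma continuous_has_antiderivative:
  fixes f :: "real \<Rightarrow> real"
  assumes "continuous_on UNIV f"
  obtains F where "\<And>x. (F has_real_derivative f x) (at x)" "F 0 = 0"
proof -
  obtain F where F: "\<And>x. (F has_vector_derivative f x) (at x)"
    using einterval_antiderivative[of "-\<infinity>" "\<infinity>" f] assms
    by (auto simp: continuous_on_eq_continuous_at)
  show ?thesis
  proof (rule that)
    show "((\<lambda>x. F x - F 0) has_real_derivative f x) (at x)" for x
      using F[of x] by (auto intro!: derivative_eq_intros simp: has_real_derivative_iff_has_vector_derivative[symmetric])
  qed simp
qed

text \<open>Approximate \<open>v\<close> uniformly by polynomials and cut these off near the end points, which gives smooth functions \<open>g\<^sub>n\<close>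
of compact support with \<open>g\<^sub>n \<rightarrow> v\<close> pointwise and boundedly. A primitive of \<open>g\<^sub>n\<close> has compact support only if
\<open>\<integral>g\<^sub>n = 0\<close>, so a multiple \<open>\<kappa>\<^sub>n \<beta>\<close> of a fixed bump is subtracted first. As \<open>\<integral>v = 0\<close>, the coefficients
\<open>\<kappa>\<^sub>n\<close> tend to zero and the limit is unchanged.\<close>

lemma derivative_approximation_by_test_functions:
  assumes L: "0 < L" and v: "continuous_on {0..L} v" and v0: "integral {0..L} v = 0"
  obtains \<phi> :: "nat \<Rightarrow> real \<Rightarrow> real" and K where
    "\<And>n. \<phi> n \<in> test_functions L"
    "\<And>x. x \<in> {0<..<L} \<Longrightarrow> (\<lambda>n. deriv (\<phi> n) x) \<longlonglongrightarrow> v x"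
    "\<And>n x. x \<in> {0<..<L} \<Longrightarrow> \<bar>deriv (\<phi> n) x - v x\<bar> \<le> K"
proof -
  have "\<forall>n::nat. \<exists>P. real_polynomial_function P \<and> (\<forall>x\<in>{0..L}. \<bar>v x - P x\<bar> < 1 / (real n + 1))"
  proof
    fix n :: nat
    show "\<exists>P. real_polynomial_function P \<and> (\<forall>x\<in>{0..L}. \<bar>v x - P x\<bar> < 1 / (real n + 1))"
    proof (rule Stone_Weierstrass_real_polynomial_function[OF compact_Icc v, of "1 / (real n + 1)"])
      show "0 < 1 / (real n + 1)" by simp
    qed blast
  qed
  then obtain P where P: "\<And>n. real_polynomial_function (P n)"
    "\<And>n x. x \<in> {0..L} \<Longrightarrow> \<bar>v x - P n x\<bar> < 1 / (real n + 1)" by metis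
  obtain V where V: "\<And>x. x \<in> {0..L} \<Longrightarrow> \<bar>v x\<bar> \<le> V"
    using compact_imp_bounded[OF compact_continuous_image[OF v compact_Icc]]
    unfolding bounded_iff by (metis image_eqI real_norm_def)
  have V0: "0 \<le> V" using V[of 0] L by auto
  \<comment> \<open>At most \<open>L / 3\<close>, so that the support of the fixed bump below stays inside \<open>[c\<^sub>n, L - c\<^sub>n]\<close>.\<close>
  define c where "c n = L / (real n + 3)" for n
  have c: "0 < c n" "c n \<le> L / 3" for n
    using L by (simp_all add: c_def field_simps)
  define g where "g n x = bump (real n) (c n) (L - c n) x * P n x" for n x
  have sg: "smooth (g n)" for n
    unfolding g_def by (intro smooth.mult smooth_bump smooth_polynomial P)
  have Plim: "(\<lambda>n. P n x) \<longlonglongrightarrow> v x" if "x \<in> {0..L}" for x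
  proof (rule LIM_zero_cancel, rule Lim_null_comparison)
    show "\<forall>\<^sub>F n in sequentially. norm (P n x - v x) \<le> 1 / (real n + 1)"
      using P(2)[OF that] by (auto simp: abs_minus_commute less_imp_le)
    show "(\<lambda>n. 1 / (real n + 1)) \<longlonglongrightarrow> 0"
      using LIMSEQ_inverse_real_of_nat by (simp add: inverse_eq_divide add.commute)
  qed
  have Pbd: "\<bar>P n x\<bar> \<le> V + 1" if "x \<in> {0..L}" for n x
  proof -
    have "1 / (real n + 1) \<le> 1" by simp
    then show ?thesis using P(2)[OF that, of n] V[OF that] by linarith
  qed
  have clim: "c \<longlonglongrightarrow> 0"
  proof -
    have "(\<lambda>n. L * (1 / real (n + 3))) \<longlonglongrightarrow> L * 0"
      by (intro tendsto_mult tendsto_const LIMSEQ_ignore_initial_segment lim_inverse_n')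
    then show ?thesis by (simp add: c_def[abs_def])
  qed
  have glim: "(\<lambda>n. g n x) \<longlonglongrightarrow> v x" if x: "x \<in> {0<..<L}" for x
  proof -
    have "(\<lambda>n. x - c n) \<longlonglongrightarrow> x - 0" "(\<lambda>n. L - c n - x) \<longlonglongrightarrow> L - 0 - x"
      by (intro tendsto_intros clim)+
    then have "filterlim (\<lambda>n. (x - c n) * real n) at_top sequentially"
      "filterlim (\<lambda>n. (L - c n - x) * real n) at_top sequentially"
      using x by (auto intro!: filterlim_tendsto_pos_mult_at_top[OF _ _ filterlim_real_sequentially])
    then have "(\<lambda>n. g n x) \<longlonglongrightarrow> 1 * 1 * v x"
      unfolding g_def bump_def using x
      by (intro tendsto_mult flat_0_tendsto_1 Plim) (auto simp: mult.commute)
    then show ?thesis by simp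
  qed
  have gbd: "\<bar>g n x\<bar> \<le> V + 1" if "x \<in> {0..L}" for n x
  proof -
    have "\<bar>g n x\<bar> \<le> 1 * (V + 1)"
      unfolding g_def abs_mult
      using bump_bounds[of "real n" "c n" "L - c n" x] Pbd[OF that, of n] by (intro mult_mono) auto
    then show ?thesis by simp
  qed
  define \<beta> where "\<beta> = bump 1 (L / 3) (2 * L / 3)"
  define b where "b = integral {0..L} \<beta>"
  have c\<beta>: "continuous_on S \<beta>" for S unfolding \<beta>_def by (intro smooth_continuous_on smooth_bump)
  have bpos: "0 < b"
  proof -
    have "0 \<le> b" unfolding b_def \<beta>_def
      by (intro integral_nonneg integrable_continuous_real smooth_continuous_on smooth_bump) (simp add: bump_bounds)
    moreover have "b \<noteq> 0"
    proof
      assume "b = 0"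
      then have "\<beta> (L / 2) = 0"
        using integral_eq_0_iff[of 0 L \<beta>] c\<beta> L bump_bounds unfolding b_def \<beta>_def by auto
      then show False using L by (auto simp: \<beta>_def bump_def flat_def field_simps)
    qed
    ultimately show ?thesis by simp
  qed
  define \<kappa> where "\<kappa> n = integral {0..L} (g n) / b" for n
  have cg: "continuous_on S (g n)" for S n using sg by (rule smooth_continuous_on)
  have "(\<lambda>n. LINT x|leb_int L. g n x) \<longlonglongrightarrow> (LINT x|leb_int L. v x)"
  proof (rule integral_dominated_convergence[where w = "\<lambda>x. V + 1"])
    show "integrable (leb_int L) (\<lambda>x. V + 1)"
      by (intro continuous_imp_integrable_leb_int continuous_intros)
    show "AE x in leb_int L. (\<lambda>n. g n x) \<longlonglongrightarrow> v x" by (intro AE_I2 glim) simp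
    show "AE x in leb_int L. norm (g n x) \<le> V + 1" for n using gbd by (intro AE_I2) auto
    show "v \<in> borel_measurable (leb_int L)" "g n \<in> borel_measurable (leb_int L)" for n
      using continuous_imp_integrable_leb_int(1)[OF v] continuous_imp_integrable_leb_int(1)[OF cg[of _ n]] by auto
  qed
  then have "(\<lambda>n. integral {0..L} (g n)) \<longlonglongrightarrow> 0"
    using v0 by (simp add: continuous_imp_integrable_leb_int(2)[OF v] continuous_imp_integrable_leb_int(2)[OF cg])
  then have \<kappa>lim: "\<kappa> \<longlonglongrightarrow> 0"
    unfolding \<kappa>_def using tendsto_divide_zero by blast
  then obtain K where K: "\<And>n. \<bar>\<kappa> n\<bar> \<le> K"
    using convergent_imp_Bseq[of \<kappa>] by (auto simp: convergent_def Bseq_def)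
  define \<psi> where "\<psi> n x = g n x + - \<kappa> n * \<beta> x" for n x
  have s\<psi>: "smooth (\<psi> n)" for n
    unfolding \<psi>_def \<beta>_def by (intro smooth.add smooth.mult smooth.const sg smooth_bump)
  have c\<psi>: "continuous_on S (\<psi> n)" for S n using s\<psi> by (rule smooth_continuous_on)
  have "\<forall>n. \<exists>F. (\<forall>x. (F has_real_derivative \<psi> n x) (at x)) \<and> F 0 = 0"
    using continuous_has_antiderivative[OF c\<psi>] by metis
  then obtain \<phi> where \<phi>: "\<And>n x. (\<phi> n has_real_derivative \<psi> n x) (at x)" "\<And>n. \<phi> n 0 = 0"
    by metis
  have FTC: "(\<psi> n has_integral \<phi> n b - \<phi> n a) {a..b}" if "a \<le> b" for n a b
    using that by (rule fundamental_theorem_of_calculus)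
      (auto intro!: DERIV_subset[OF \<phi>(1)] simp flip: has_real_derivative_iff_has_vector_derivative)
  have \<psi>0: "\<psi> n x = 0" if "x \<le> c n \<or> L - c n \<le> x" for n x
    using that c(2)[of n] L by (auto simp: \<psi>_def g_def \<beta>_def bump_outside)
  have flat: "\<phi> n a = \<phi> n b" if "a \<le> b" "b \<le> c n \<or> L - c n \<le> a" for n a b
  proof -
    have "(\<psi> n has_integral 0) {a..b}"
      by (rule has_integral_is_0) (use that \<psi>0 in auto)
    from has_integral_unique[OF this FTC[OF that(1), of n]] show ?thesis by simp
  qed
  have \<phi>L: "\<phi> n L = 0" for n
  proof -
    have "integral {0..L} (\<psi> n) = integral {0..L} (g n) - \<kappa> n * b"
      unfolding \<psi>_def b_def using cg c\<beta>
      by (subst Henstock_Kurzweil_Integration.integral_add) (auto intro!: integrable_continuous_real continuous_intros)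
    also have "\<dots> = 0" using bpos by (simp add: \<kappa>_def)
    finally show ?thesis using FTC[of 0 L n] L \<phi>(2)[of n] by (simp add: integral_unique)
  qed
  have \<phi>out: "\<phi> n x = 0" if "x \<notin> {c n..L - c n}" for n x
  proof (cases "x < c n")
    case True
    then show ?thesis using flat[of x 0 n] flat[of 0 x n] \<phi>(2)[of n] c(1)[of n] by (cases "x \<le> 0") auto
  next
    case False
    then show ?thesis using that flat[of x L n] flat[of L x n] \<phi>L[of n] c(1)[of n] by (cases "x \<le> L") auto
  qed
  have d\<phi>: "deriv (\<phi> n) x = \<psi> n x" for n x by (rule DERIV_imp_deriv[OF \<phi>(1)])
  show ?thesis
  proof (rule that[of \<phi> "(V + 1) + K + V"])
    show "\<phi> n \<in> test_functions L" for n
      by (rule test_functionsI[of _ "c n" "L - c n"])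
        (use \<phi>out c(1)[of n] smooth.primitive[OF \<phi>(1) s\<psi>] in auto)
    show "(\<lambda>n. deriv (\<phi> n) x) \<longlonglongrightarrow> v x" if "x \<in> {0<..<L}" for x
    proof -
      have "(\<lambda>n. g n x + - \<kappa> n * \<beta> x) \<longlonglongrightarrow> v x + - 0 * \<beta> x"
        by (intro tendsto_intros glim that \<kappa>lim)
      then show ?thesis by (simp add: d\<phi> \<psi>_def)
    qed
    show "\<bar>deriv (\<phi> n) x - v x\<bar> \<le> (V + 1) + K + V" if "x \<in> {0<..<L}" for n x
    proof -
      have "\<bar>\<kappa> n * \<beta> x\<bar> \<le> K * 1"
        unfolding abs_mult \<beta>_def using K[of n] bump_bounds by (intro mult_mono) auto
      then show ?thesis
        using gbd[of x n] V[of x] that by (simp add: d\<phi> \<psi>_def)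
    qed
  qed
qed

text \<open>The derivatives of the approximating test functions converge boundedly, hence in every \<open>L\<^sup>s\<close>. Convergence in
\<open>L\<^sup>1\<close> makes the functions themselves converge uniformly, because all of them vanish at \<open>0\<close>.\<close>

lemma W1p0I:
  assumes p: "1 < p" and L: "0 < L" and u: "continuous_on {0..L} u" "u 0 = 0" "u L = 0"
    and v: "continuous_on {0..L} v"
    and fin: "finite S" and der: "\<And>x. x \<in> {0<..<L} - S \<Longrightarrow> (u has_real_derivative v x) (at x)"
  shows "u \<in> W1p0 p L"
proof -
  have FTC: "(v has_integral u x) {0..x}" if "0 \<le> x" "x \<le> L" for x
  proof -
    have "(v has_integral u x - u 0) {0..x}"
      by (rule fundamental_theorem_of_calculus_interior_strong[OF fin])
        (use that der continuous_on_subset[OF u(1)] in \<open>auto simp flip: has_real_derivative_iff_has_vector_derivative\<close>)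
    then show ?thesis using u by simp
  qed
  have "integral {0..L} v = 0" using FTC[of L] L u by (simp add: integral_unique)
  then obtain \<phi> :: "nat \<Rightarrow> real \<Rightarrow> real" and K where \<phi>: "\<And>n. \<phi> n \<in> test_functions L"
    and lim: "\<And>x. x \<in> {0<..<L} \<Longrightarrow> (\<lambda>n. deriv (\<phi> n) x) \<longlonglongrightarrow> v x"
    and K: "\<And>n x. x \<in> {0<..<L} \<Longrightarrow> \<bar>deriv (\<phi> n) x - v x\<bar> \<le> K"
    using derivative_approximation_by_test_functions[OF L v] by blast
  note P = test_function_properties[OF \<phi>]
  have lim_deriv: "(\<lambda>n. Lp_norm (leb_int L) s (\<lambda>x. deriv (\<phi> n) x - v x)) \<longlonglongrightarrow> 0" if "0 < s" for s
    by (rule Lp_norm_tendsto_0_bounded[OF that L P(2) v lim K])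
  have diff: "\<bar>\<phi> n x - u x\<bar> \<le> Lp_norm (leb_int L) 1 (\<lambda>x. deriv (\<phi> n) x - v x)" if "x \<in> {0..L}" for n x
  proof -
    have c: "continuous_on S (\<lambda>x. \<bar>deriv (\<phi> n) x - v x\<bar>)" if "S \<subseteq> {0..L}" for S
      using P(2) continuous_on_subset[OF v that] by (intro continuous_intros)
    have "(deriv (\<phi> n) has_integral \<phi> n x - \<phi> n 0) {0..x}"
      using that by (intro fundamental_theorem_of_calculus)
        (auto intro!: DERIV_subset[OF P(1)] simp flip: has_real_derivative_iff_has_vector_derivative)
    then have "((\<lambda>x. deriv (\<phi> n) x - v x) has_integral \<phi> n x - u x) {0..x}"
      using FTC[of x] that P(4) by (auto intro: has_integral_diff)
    then have "\<bar>\<phi> n x - u x\<bar> \<le> integral {0..x} (\<lambda>x. \<bar>deriv (\<phi> n) x - v x\<bar>)"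
      using integral_norm_bound_integral[of "\<lambda>x. deriv (\<phi> n) x - v x" "{0..x}" "\<lambda>x. \<bar>deriv (\<phi> n) x - v x\<bar>"]
        integrable_continuous_real[OF c[of "{0..x}"]] that by (auto simp: has_integral_iff)
    also have "\<dots> \<le> integral {0..L} (\<lambda>x. \<bar>deriv (\<phi> n) x - v x\<bar>)"
      using that by (intro integral_subset_le integrable_continuous_real c) auto
    also have "\<dots> = (LINT x|leb_int L. \<bar>deriv (\<phi> n) x - v x\<bar>)"
      by (rule continuous_imp_integrable_leb_int(2)[symmetric]) (rule c, simp)
    finally show ?thesis by (simp add: Lp_norm_def)
  qed
  have lim1: "(\<lambda>n. Lp_norm (leb_int L) 1 (\<lambda>x. deriv (\<phi> n) x - v x)) \<longlonglongrightarrow> 0"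
    by (rule lim_deriv) simp
  then obtain K' where K': "\<And>n. Lp_norm (leb_int L) 1 (\<lambda>x. deriv (\<phi> n) x - v x) \<le> K'"
    using convergent_imp_Bseq[of "\<lambda>n. Lp_norm (leb_int L) 1 (\<lambda>x. deriv (\<phi> n) x - v x)"]
    by (auto simp: convergent_def Bseq_def Lp_norm_nonneg)
  have "(\<lambda>n. Lp_norm (leb_int L) p (\<lambda>x. \<phi> n x - u x)) \<longlonglongrightarrow> 0"
  proof (rule Lp_norm_tendsto_0_bounded[OF _ L P(3) u(1)])
    show "(\<lambda>n. \<phi> n x) \<longlonglongrightarrow> u x" if "x \<in> {0<..<L}" for x
      by (rule LIM_zero_cancel, rule Lim_null_comparison[OF _ lim1]) (use diff[of x] that in auto)
    show "\<bar>\<phi> n x - u x\<bar> \<le> K'" if "x \<in> {0<..<L}" for n x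
      using diff[of x n] K'[of n] that by auto
  qed (use p in simp)
  moreover have "u \<in> Lp_space (leb_int L) p" "v \<in> Lp_space (leb_int L) p"
    using u v p by (auto intro: continuous_imp_Lp_space)
  ultimately show ?thesis
    unfolding W1p0_def using weak_derivI[OF L u(1) v fin der] \<phi> lim_deriv[of p] p by auto
qed

section \<open>The lower bound\<close>

lemma abs_powr_minus_2_mult:
  fixes x p :: real
  shows "\<bar>\<bar>x\<bar> powr (p - 2) * x\<bar> = \<bar>x\<bar> powr (p - 1)" "\<bar>x\<bar> powr (p - 2) * x * x = \<bar>x\<bar> powr p"
proof -
  have "\<bar>x\<bar> powr (p - 2) * \<bar>x\<bar> = \<bar>x\<bar> powr (p - 1)"
    by (cases "x = 0") (use powr_add[of "\<bar>x\<bar>" "p - 2" 1] in auto)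
  then show "\<bar>\<bar>x\<bar> powr (p - 2) * x\<bar> = \<bar>x\<bar> powr (p - 1)"
    by (simp add: abs_mult)
  have "\<bar>x\<bar> powr (p - 2) * \<bar>x\<bar> powr 2 = \<bar>x\<bar> powr p"
    by (simp only: powr_add[symmetric]) simp
  moreover have "x * x = \<bar>x\<bar> powr 2"
    by (simp add: power2_eq_square)
  ultimately show "\<bar>x\<bar> powr (p - 2) * x * x = \<bar>x\<bar> powr p"
    by (simp only: mult.assoc)
qed

lemma Lp_space_powr_minus_2_mult:
  assumes pq: "1 < p" "1 < q" "1 / p + 1 / q = 1" and f: "f \<in> Lp_space M p"
  shows "(\<lambda>x. \<bar>f x\<bar> powr (p - 2) * f x) \<in> Lp_space M q"
proof -
  have [measurable]: "f \<in> borel_measurable M" using f by (simp add: Lp_space_def)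
  have "(\<lambda>x. \<bar>f x\<bar> powr (p - 2) * f x) \<in> borel_measurable M" by measurable
  then show ?thesis
    using Lp_space_powr_conj(1)[OF pq f] by (simp add: Lp_space_def abs_powr_minus_2_mult)
qed

lemma Lp_space_bounded_mult:
  assumes "0 < q" and a[measurable]: "a \<in> borel_measurable M" and C: "AE x in M. \<bar>a x\<bar> \<le> C" and f: "f \<in> Lp_space M q"
  shows "(\<lambda>x. a x * f x) \<in> Lp_space M q"
proof -
  have [measurable]: "f \<in> borel_measurable M" using f by (simp add: Lp_space_def)
  have "integrable M (\<lambda>x. \<bar>a x * f x\<bar> powr q)"
  proof (rule Bochner_Integration.integrable_bound)
    show "integrable M (\<lambda>x. C powr q * \<bar>f x\<bar> powr q)" using f by (simp add: Lp_space_def)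
    show "AE x in M. norm (\<bar>a x * f x\<bar> powr q) \<le> norm (C powr q * \<bar>f x\<bar> powr q)"
      using C
    proof eventually_elim
      case (elim x)
      then have "\<bar>a x\<bar> powr q \<le> C powr q" using assms(1) by (intro powr_mono2) auto
      then show ?case by (simp add: abs_mult powr_mult mult_right_mono)
    qed
  qed measurable
  then show ?thesis by (simp add: Lp_space_def)
qed

lemma Linf_space_imp_Lp_space:
  assumes "0 < q" "a \<in> Linf_space (leb_int L)"
  shows "a \<in> Lp_space (leb_int L) q"
proof -
  obtain C where C: "AE x in leb_int L. \<bar>a x\<bar> \<le> C" and a: "a \<in> borel_measurable (leb_int L)"
    using assms(2) by (auto simp: Linf_space_def)
  have "(\<lambda>x. 1) \<in> Lp_space (leb_int L) q"
    using assms(1) by (intro continuous_imp_Lp_space) auto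
  from Lp_space_bounded_mult[OF assms(1) a C this] show ?thesis by simp
qed

text \<open>Testing the equation with the approximating test functions \<open>\<phi>\<^sub>n \<rightarrow> u\<close> gives \<open>\<integral>|g|\<^sup>p = \<integral>a |u|\<^sup>p\<close> in the
limit. The hypothesis on \<open>N\<close> and the Sobolev inequality give \<open>K \<integral>a |\<phi>\<^sub>n|\<^sup>p \<le> N \<integral>|\<phi>\<^sub>n'|\<^sup>p\<close>, and in the limit
\<open>K \<integral>|g|\<^sup>p \<le> N \<integral>|g|\<^sup>p\<close>. The Sobolev inequality with \<open>r = p\<close> shows that \<open>\<integral>|g|\<^sup>p > 0\<close>, since
\<open>u\<close> is not zero almost everywhere. The bound \<open>N\<close> stands for \<open>\<parallel>a\<parallel>\<^sub>q\<close> for all \<open>q\<close>, including \<open>q = \<infinity>\<close>.\<close>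

proposition Lambda_weight_ge_sobolev_const:
  assumes p: "1 < p" and L: "0 < L" and r: "0 < r" and a: "a \<in> Lambda p L" and N: "0 \<le> N"
    and le: "\<And>\<phi>. \<phi> \<in> test_functions L \<Longrightarrow>
      (LINT x|leb_int L. a x * \<bar>\<phi> x\<bar> powr p) \<le> N * (LINT x|leb_int L. \<bar>\<phi> x\<bar> powr r) powr (p / r)"
  shows "sobolev_const p r L \<le> N"
proof -
  let ?M = "leb_int L" and ?q = "conj_exp p"
  note pq = p conj_exp_bounds(1,2)[OF p]
  obtain C where C: "AE x in ?M. \<bar>a x\<bar> \<le> C" and am: "a \<in> borel_measurable ?M"
    using a by (auto simp: Lambda_def Linf_space_def)
  obtain u where sol: "weak_solution p L a u" and nz: "\<not> (AE x in ?M. u x = 0)"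
    using a by (auto simp: Lambda_def)
  obtain g where g: "g \<in> Lp_space ?M p" "weak_deriv L u g" and eq: "\<And>\<phi>. \<phi> \<in> test_functions L \<Longrightarrow>
     (LINT x|?M. \<bar>g x\<bar> powr (p - 2) * g x * deriv \<phi> x) = (LINT x|?M. a x * \<bar>u x\<bar> powr (p - 2) * u x * \<phi> x)"
    using sol by (auto simp: weak_solution_def)
  have u: "u \<in> Lp_space ?M p" and "u \<in> W1p0 p L" using sol by (auto simp: weak_solution_def W1p0_def)
  then obtain g' and \<phi> :: "nat \<Rightarrow> real \<Rightarrow> real" where g': "g' \<in> Lp_space ?M p" "weak_deriv L u g'"
    and \<phi>: "\<And>n. \<phi> n \<in> test_functions L"
    and lim: "(\<lambda>n. Lp_norm ?M p (\<lambda>x. \<phi> n x - u x)) \<longlonglongrightarrow> 0"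
    and lim': "(\<lambda>n. Lp_norm ?M p (\<lambda>x. deriv (\<phi> n) x - g' x)) \<longlonglongrightarrow> 0"
    unfolding W1p0_def by blast
  note P = test_function_properties[OF \<phi>]
  have [measurable]: "g \<in> borel_measurable ?M" "g' \<in> borel_measurable ?M"
    and F'm[measurable]: "deriv (\<phi> n) \<in> borel_measurable ?M" for n
    using g g' continuous_imp_integrable_leb_int(1)[OF P(2)] by (auto simp: Lp_space_def)
  have ae: "AE x in ?M. g x = g' x"
    by (rule weak_deriv_unique[OF p g(1) g'(1) g(2) g'(2)])
  have "Lp_norm ?M p (\<lambda>x. deriv (\<phi> n) x - g' x) = Lp_norm ?M p (\<lambda>x. deriv (\<phi> n) x - g x)" for n
  proof -
    have "(LINT x|?M. \<bar>deriv (\<phi> n) x - g' x\<bar> powr p) = (LINT x|?M. \<bar>deriv (\<phi> n) x - g x\<bar> powr p)"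
    proof (rule integral_cong_AE)
      show "AE x in ?M. \<bar>deriv (\<phi> n) x - g' x\<bar> powr p = \<bar>deriv (\<phi> n) x - g x\<bar> powr p"
        using ae by eventually_elim simp
    qed measurable
    then show ?thesis by (simp add: Lp_norm_def)
  qed
  then have limg: "(\<lambda>n. Lp_norm ?M p (\<lambda>x. deriv (\<phi> n) x - g x)) \<longlonglongrightarrow> 0"
    using lim' by simp
  have F: "\<phi> n \<in> Lp_space ?M p" and F': "deriv (\<phi> n) \<in> Lp_space ?M p" for n
    using P(2,3) p by (auto intro: continuous_imp_Lp_space)
  let ?G = "LINT x|?M. \<bar>g x\<bar> powr p" and ?U = "LINT x|?M. a x * \<bar>u x\<bar> powr p"
  have hg: "(\<lambda>x. \<bar>g x\<bar> powr (p - 2) * g x) \<in> Lp_space ?M ?q"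
    by (rule Lp_space_powr_minus_2_mult[OF pq g(1)])
  have hu: "(\<lambda>x. a x * (\<bar>u x\<bar> powr (p - 2) * u x)) \<in> Lp_space ?M ?q"
    using conj_exp_bounds(3)[OF p] by (intro Lp_space_bounded_mult[OF _ am C] Lp_space_powr_minus_2_mult[OF pq u])
  have "(\<lambda>n. LINT x|?M. \<bar>g x\<bar> powr (p - 2) * g x * deriv (\<phi> n) x) \<longlonglongrightarrow> ?G"
    using Lp_tendsto_integral_mult[OF pq F' g(1) hg limg] by (simp add: abs_powr_minus_2_mult)
  moreover have "(\<lambda>n. LINT x|?M. a x * (\<bar>u x\<bar> powr (p - 2) * u x) * \<phi> n x) \<longlonglongrightarrow> ?U"
    using Lp_tendsto_integral_mult[OF pq F u hu lim] by (simp add: abs_powr_minus_2_mult mult.assoc[of "a _"])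
  ultimately have GU: "?G = ?U"
    using eq[OF \<phi>] by (auto intro: LIMSEQ_unique simp: mult.assoc)
  have limG: "(\<lambda>n. LINT x|?M. \<bar>deriv (\<phi> n) x\<bar> powr p) \<longlonglongrightarrow> ?G"
    using Lp_tendsto_weighted_power[of p "\<lambda>x. 1" ?M 1, OF p _ _ F' g(1) limg] by simp
  have limU: "(\<lambda>n. LINT x|?M. a x * \<bar>\<phi> n x\<bar> powr p) \<longlonglongrightarrow> ?U"
    by (rule Lp_tendsto_weighted_power[OF p am C F u lim])
  have limu: "(\<lambda>n. LINT x|?M. \<bar>\<phi> n x\<bar> powr p) \<longlonglongrightarrow> (LINT x|?M. \<bar>u x\<bar> powr p)"
    using Lp_tendsto_weighted_power[of p "\<lambda>x. 1" ?M 1, OF p _ _ F u lim] by simp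
  have sob: "sobolev_const p s L * (LINT x|?M. \<bar>\<phi> n x\<bar> powr s) powr (p / s) \<le> (LINT x|?M. \<bar>deriv (\<phi> n) x\<bar> powr p)"
    if "0 < s" for s n
    by (rule sharp_Sobolev_inequality[OF p that L P(1,2,4,5)])
  have G: "0 < ?G"
  proof -
    have "sobolev_const p p L * (LINT x|?M. \<bar>u x\<bar> powr p) \<le> ?G"
    proof (rule LIMSEQ_le[OF tendsto_mult[OF tendsto_const limu] limG])
      show "\<exists>N. \<forall>n\<ge>N. sobolev_const p p L * (LINT x|?M. \<bar>\<phi> n x\<bar> powr p) \<le> (LINT x|?M. \<bar>deriv (\<phi> n) x\<bar> powr p)"
        using sob[of p] p by (auto simp: Bochner_Integration.integral_nonneg)
    qed
    moreover have "0 < (LINT x|?M. \<bar>u x\<bar> powr p)"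
    proof -
      have "Lp_norm ?M p u \<noteq> 0" using Lp_norm_zero_AE[OF u] nz p by auto
      then have "0 < Lp_norm ?M p u powr p" using Lp_norm_nonneg[of ?M p u] by simp
      then show ?thesis using p by (simp add: Lp_norm_powr)
    qed
    ultimately show ?thesis
      using sobolev_const_pos[of p p L] p L by (smt (verit) mult_pos_pos)
  qed
  have "sobolev_const p r L * ?U \<le> N * ?G"
  proof (rule LIMSEQ_le[OF tendsto_mult[OF tendsto_const limU] tendsto_mult[OF tendsto_const limG]])
    have "sobolev_const p r L * (LINT x|?M. a x * \<bar>\<phi> n x\<bar> powr p) \<le> N * (LINT x|?M. \<bar>deriv (\<phi> n) x\<bar> powr p)" for n
    proof -
      have "sobolev_const p r L * (LINT x|?M. a x * \<bar>\<phi> n x\<bar> powr p)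
          \<le> sobolev_const p r L * (N * (LINT x|?M. \<bar>\<phi> n x\<bar> powr r) powr (p / r))"
        using sobolev_const_pos[OF p r L] by (intro mult_left_mono le \<phi>) auto
      also have "\<dots> = N * (sobolev_const p r L * (LINT x|?M. \<bar>\<phi> n x\<bar> powr r) powr (p / r))" by simp
      also have "\<dots> \<le> N * (LINT x|?M. \<bar>deriv (\<phi> n) x\<bar> powr p)"
        by (intro mult_left_mono sob r N)
      finally show ?thesis .
    qed
    then show "\<exists>n0. \<forall>n\<ge>n0. sobolev_const p r L * (LINT x|?M. a x * \<bar>\<phi> n x\<bar> powr p)
        \<le> N * (LINT x|?M. \<bar>deriv (\<phi> n) x\<bar> powr p)" by blast
  qed
  then show ?thesis using G unfolding GU[symmetric] by simp
qed

lemma Lambda_Lp_norm_ge: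
  assumes p: "1 < p" and L: "0 < L" and q: "1 < q" and a: "a \<in> Lambda p L"
  shows "sobolev_const p (p * conj_exp q) L \<le> Lp_norm (leb_int L) q a"
proof (rule Lambda_weight_ge_sobolev_const[OF p L _ a])
  note qq = q conj_exp_bounds(1,2)[OF q]
  show "0 < p * conj_exp q" using p conj_exp_bounds[OF q] by simp
  show "0 \<le> Lp_norm (leb_int L) q a" by (rule Lp_norm_nonneg)
  fix \<phi> assume \<phi>: "\<phi> \<in> test_functions L"
  let ?M = "leb_int L" and ?f = "\<lambda>x. \<bar>\<phi> x\<bar> powr p"
  have aq: "a \<in> Lp_space ?M q"
    using a q by (intro Linf_space_imp_Lp_space) (auto simp: Lambda_def)
  have f: "?f \<in> Lp_space ?M (conj_exp q)"
    using test_function_properties(3)[OF \<phi>] p conj_exp_bounds[OF q]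
    by (intro continuous_imp_Lp_space continuous_on_powr' continuous_intros) auto
  have "(LINT x|?M. a x * ?f x) \<le> (LINT x|?M. \<bar>a x * ?f x\<bar>)"
    using Hoelder_inequality(1)[OF qq aq f] by (intro integral_mono) auto
  also have "\<dots> \<le> Lp_norm ?M q a * Lp_norm ?M (conj_exp q) ?f"
    by (rule Hoelder_inequality(2)[OF qq aq f])
  also have "Lp_norm ?M (conj_exp q) ?f = (LINT x|?M. \<bar>\<phi> x\<bar> powr (p * conj_exp q)) powr (p / (p * conj_exp q))"
    using p by (simp add: Lp_norm_def powr_powr)
  finally show "(LINT x|?M. a x * ?f x)
    \<le> Lp_norm ?M q a * (LINT x|?M. \<bar>\<phi> x\<bar> powr (p * conj_exp q)) powr (p / (p * conj_exp q))" .
qed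

lemma Linf_norm_AE_le:
  assumes "a \<in> Linf_space M" "emeasure M (space M) \<noteq> 0"
  shows "0 \<le> Linf_norm M a" "AE x in M. \<bar>a x\<bar> \<le> Linf_norm M a"
proof -
  obtain C where C: "AE x in M. \<bar>a x\<bar> \<le> C" and [measurable]: "a \<in> borel_measurable M"
    using assms(1) by (auto simp: Linf_space_def)
  let ?f = "\<lambda>x. ereal \<bar>a x\<bar>"
  have m: "?f \<in> borel_measurable M" by measurable
  have le: "esssup M ?f \<le> ereal C" using C by (intro esssup_I m) auto
  have "esssup M (\<lambda>x. 0::ereal) \<le> esssup M ?f" by (intro esssup_AE_mono) auto
  then have ge: "0 \<le> esssup M ?f" using esssup_const[OF assms(2), of "0::ereal"] by simp
  have e: "esssup M ?f = ereal (Linf_norm M a)"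
    unfolding Linf_norm_def using le ge by (cases "esssup M ?f") auto
  show "0 \<le> Linf_norm M a" using ge e by simp
  show "AE x in M. \<bar>a x\<bar> \<le> Linf_norm M a" using esssup_AE[of ?f M] unfolding e by simp
qed

lemma emeasure_leb_int: "0 < L \<Longrightarrow> emeasure (leb_int L) (space (leb_int L)) = ennreal L"
  by (simp add: emeasure_restrict_space)

lemma Lambda_Linf_norm_ge:
  assumes p: "1 < p" and L: "0 < L" and a: "a \<in> Lambda p L"
  shows "sobolev_const p p L \<le> Linf_norm (leb_int L) a"
proof (rule Lambda_weight_ge_sobolev_const[OF p L _ a])
  let ?M = "leb_int L"
  have aL: "a \<in> Linf_space ?M" using a by (simp add: Lambda_def)
  note A = Linf_norm_AE_le[OF aL, unfolded emeasure_leb_int[OF L]]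
  show "0 < p" using p by simp
  show "0 \<le> Linf_norm ?M a" using A(1) L by simp
  fix \<phi> assume \<phi>: "\<phi> \<in> test_functions L"
  have f: "integrable ?M (\<lambda>x. \<bar>\<phi> x\<bar> powr p)"
    using continuous_imp_Lp_space[OF test_function_properties(3)[OF \<phi>], of p] p by (simp add: Lp_space_def)
  have [measurable]: "a \<in> borel_measurable ?M" "\<phi> \<in> borel_measurable ?M"
    using aL continuous_imp_integrable_leb_int(1)[OF test_function_properties(3)[OF \<phi>]] by (auto simp: Linf_space_def)
  have AE: "AE x in ?M. a x * \<bar>\<phi> x\<bar> powr p \<le> Linf_norm ?M a * \<bar>\<phi> x\<bar> powr p"
    "AE x in ?M. norm (a x * \<bar>\<phi> x\<bar> powr p) \<le> norm (Linf_norm ?M a * \<bar>\<phi> x\<bar> powr p)"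
    using A(2) L by (auto elim!: eventually_mono simp: abs_mult intro!: mult_right_mono)
  have m: "(\<lambda>x. a x * \<bar>\<phi> x\<bar> powr p) \<in> borel_measurable ?M" by measurable
  have "integrable ?M (\<lambda>x. a x * \<bar>\<phi> x\<bar> powr p)"
    by (rule Bochner_Integration.integrable_bound[OF _ m AE(2)]) (use f in simp)
  then have "(LINT x|?M. a x * \<bar>\<phi> x\<bar> powr p) \<le> (LINT x|?M. Linf_norm ?M a * \<bar>\<phi> x\<bar> powr p)"
    using f AE(1) by (intro integral_mono_AE) auto
  also have "\<dots> = Linf_norm ?M a * (LINT x|?M. \<bar>\<phi> x\<bar> powr p) powr (p / p)"
    using p by (simp add: Bochner_Integration.integral_nonneg)
  finally show "(LINT x|?M. a x * \<bar>\<phi> x\<bar> powr p)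
    \<le> Linf_norm ?M a * (LINT x|?M. \<bar>\<phi> x\<bar> powr p) powr (p / p)" .
qed

section \<open>The extremal solution\<close>

definition scaled_sin :: "real \<Rightarrow> real \<Rightarrow> real \<Rightarrow> real \<Rightarrow> real" where
  "scaled_sin p r L x = sin_pq p r (pi_pq p r / L * x)"

text \<open>The extremal function is symmetric about \<open>L / 2\<close>, so its derivative and its flux have this antisymmetric form.
At \<open>L / 2\<close> the two branches agree only if \<open>f\<close> vanishes there.\<close>

definition odd_about_middle :: "real \<Rightarrow> (real \<Rightarrow> real) \<Rightarrow> real \<Rightarrow> real" where
  "odd_about_middle L f x = (if x \<le> L / 2 then f x else - f x)"

lemma continuous_on_odd_about_middle:
  assumes "continuous_on S f" "f (L / 2) = 0"
  shows "continuous_on S (odd_about_middle L f)"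
  unfolding odd_about_middle_def[abs_def] using assms
  by (intro continuous_on_cases_le) (auto intro!: continuous_intros elim: continuous_on_subset)

lemma odd_about_middle_derivative:
  assumes "x \<noteq> L / 2" "(f has_real_derivative D) (at x)"
  shows "(odd_about_middle L f has_real_derivative (if x \<le> L / 2 then 1 else - 1) * D) (at x)"
proof (cases "x < L / 2")
  case True
  have "(odd_about_middle L f has_real_derivative D) (at x)"
    by (rule has_field_derivative_transform_within_open[OF assms(2), of "{..<L / 2}"])
      (use True in \<open>auto simp: odd_about_middle_def\<close>)
  then show ?thesis using True by simp
next
  case False
  have "(odd_about_middle L f has_real_derivative - D) (at x)"
    by (rule has_field_derivative_transform_within_open[OF DERIV_minus[OF assms(2)], of "{L / 2<..}"])
      (use False assms(1) in \<open>auto simp: odd_about_middle_def\<close>)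
  then show ?thesis using False assms(1) by simp
qed

lemma powr_minus_2_mult: "0 \<le> y \<Longrightarrow> \<bar>y\<bar> powr (p - 2) * y = y powr (p - 1)" for y p :: real
  using abs_powr_minus_2_mult(1)[of y p] by (simp add: abs_mult)

lemma powr_minus_1_mult: "0 \<le> y \<Longrightarrow> y powr (a - 1) * y = y powr a" for y a :: real
  using powr_add[of y "a - 1" 1] by simp

context
  fixes p r L :: real
  assumes p: "1 < p" and r: "1 < r" and L: "0 < L"
begin

private lemma r0: "0 < r" using r by simp

private lemma pi_pos: "0 < pi_pq p r" by (rule pi_pq_pos[OF p r0])

lemma scaled_sin_range: "x \<in> {0..L} \<Longrightarrow> 0 \<le> scaled_sin p r L x" "x \<in> {0..L} \<Longrightarrow> scaled_sin p r L x \<le> 1"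
  unfolding scaled_sin_def using pi_pos L
  by (auto intro!: sin_pq_range[OF p r0] simp: field_simps)

lemma scaled_sin_interior:
  assumes "x \<in> {0<..<L}"
  shows "0 < scaled_sin p r L x" "x \<noteq> L / 2 \<Longrightarrow> scaled_sin p r L x < 1"
proof -
  define y where "y = pi_pq p r / L * x"
  have y: "0 < y" "y < pi_pq p r" "x < L / 2 \<longleftrightarrow> y < pi_pq p r / 2" "x = L / 2 \<longleftrightarrow> y = pi_pq p r / 2"
    using assms pi_pos L by (auto simp: y_def field_simps)
  consider "y < pi_pq p r / 2" | "y = pi_pq p r / 2" | "pi_pq p r - y < pi_pq p r / 2" by linarith
  then have "0 < sin_pq p r y \<and> (x \<noteq> L / 2 \<longrightarrow> sin_pq p r y < 1)"
  proof cases
    case 1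
    then show ?thesis using sin_pq_interior[OF p r0, of y] y by simp
  next
    case 2
    have "sin_pq p r y = 1" using 2 sin_pq_pi_half[OF p r0] by (simp only:)
    moreover have "x = L / 2" using 2 y(4) by blast
    ultimately show ?thesis by simp
  next
    case 3
    then show ?thesis using sin_pq_interior[OF p r0, of "pi_pq p r - y"] y by (simp add: sin_pq_reflect)
  qed
  then show "0 < scaled_sin p r L x" "x \<noteq> L / 2 \<Longrightarrow> scaled_sin p r L x < 1"
    by (auto simp: scaled_sin_def y_def)
qed

lemma continuous_on_scaled_sin: "continuous_on {0..L} (scaled_sin p r L)"
  unfolding scaled_sin_def[abs_def] using pi_pos L
  by (intro continuous_on_compose2[OF continuous_on_sin_pq[OF p r0]]) (auto intro!: continuous_intros simp: field_simps)

lemma scaled_sin_special: "scaled_sin p r L 0 = 0" "scaled_sin p r L L = 0" "scaled_sin p r L (L / 2) = 1"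
  using L sin_pq_pi_half[OF p r0] by (auto simp: scaled_sin_def sin_pq_0[OF p r0] sin_pq_pi[OF p r0])

definition scaled_sin_slope :: "real \<Rightarrow> real" where
  "scaled_sin_slope = odd_about_middle L (\<lambda>x. pi_pq p r / L * (1 - scaled_sin p r L x powr r) powr (1 / p))"

text \<open>The quantity \<open>|u'|\<^bsup>p-2\<^esup> u'\<close> for \<open>u = scaled_sin p r L\<close>; see \<open>flux_eq\<close>.\<close>

definition scaled_sin_flux :: "real \<Rightarrow> real" where
  "scaled_sin_flux = odd_about_middle L
    (\<lambda>x. (pi_pq p r / L) powr (p - 1) * (1 - scaled_sin p r L x powr r) powr (1 / conj_exp p))"

lemma scaled_sin_powr_le_1: "x \<in> {0..L} \<Longrightarrow> scaled_sin p r L x powr r \<le> 1"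
  using scaled_sin_range[of x] r by (intro powr_le1) auto

lemma continuous_on_scaled_sin_powr: "0 < b \<Longrightarrow> continuous_on {0..L} (\<lambda>x. scaled_sin p r L x powr b)"
proof (rule continuous_on_powr'[OF continuous_on_scaled_sin continuous_on_const])
qed (use scaled_sin_range(1) in auto)

lemma continuous_on_cofunction_powr:
  assumes "0 < b"
  shows "continuous_on {0..L} (\<lambda>x. (1 - scaled_sin p r L x powr r) powr b)"
proof (rule continuous_on_powr')
  show "continuous_on {0..L} (\<lambda>x. 1 - scaled_sin p r L x powr r)"
    by (intro continuous_on_diff continuous_on_const continuous_on_scaled_sin_powr r0)
qed (use assms scaled_sin_powr_le_1 in auto)

lemma continuous_on_slope: "continuous_on {0..L} scaled_sin_slope"
  unfolding scaled_sin_slope_def using p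
  by (intro continuous_on_odd_about_middle continuous_on_mult continuous_on_const continuous_on_cofunction_powr)
    (simp_all add: scaled_sin_special)

lemma continuous_on_flux: "continuous_on {0..L} scaled_sin_flux"
  unfolding scaled_sin_flux_def using conj_exp_bounds(3)[OF p]
  by (intro continuous_on_odd_about_middle continuous_on_mult continuous_on_const continuous_on_cofunction_powr)
    (simp_all add: scaled_sin_special)

lemma scaled_sin_derivative:
  assumes "x \<in> {0<..<L} - {L / 2}"
  shows "(scaled_sin p r L has_real_derivative scaled_sin_slope x) (at x)"
proof (cases "x < L / 2")
  case True
  have "(scaled_sin p r L has_real_derivative (1 - scaled_sin p r L x powr r) powr (1 / p) * (pi_pq p r / L)) (at x)"
    unfolding scaled_sin_def[abs_def] scaled_sin_def
    by (rule DERIV_chain2[OF sin_pq_derivative_left[OF p r0]])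
      (use assms True pi_pos L in \<open>auto intro!: derivative_eq_intros simp: field_simps\<close>)
  then show ?thesis using True by (simp add: scaled_sin_slope_def odd_about_middle_def mult.commute)
next
  case False
  then have "L / 2 < x" using assms by auto
  have "(scaled_sin p r L has_real_derivative - ((1 - scaled_sin p r L x powr r) powr (1 / p)) * (pi_pq p r / L)) (at x)"
    unfolding scaled_sin_def[abs_def] scaled_sin_def
    by (rule DERIV_chain2[OF sin_pq_derivative_right[OF p r0]])
      (use assms \<open>L / 2 < x\<close> pi_pos L in \<open>auto intro!: derivative_eq_intros simp: field_simps\<close>)
  then show ?thesis using \<open>L / 2 < x\<close> by (simp add: scaled_sin_slope_def odd_about_middle_def mult.commute)
qed

lemma flux_eq: "x \<in> {0..L} \<Longrightarrow> \<bar>scaled_sin_slope x\<bar> powr (p - 2) * scaled_sin_slope x = scaled_sin_flux x"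
proof -
  assume x: "x \<in> {0..L}"
  let ?s = "pi_pq p r / L * (1 - scaled_sin p r L x powr r) powr (1 / p)"
  have s0: "0 \<le> ?s" using pi_pos L by simp
  have "\<bar>?s\<bar> powr (p - 2) * ?s = ?s powr (p - 1)"
    by (rule powr_minus_2_mult[OF s0])
  also have "\<dots> = (pi_pq p r / L) powr (p - 1) * (1 - scaled_sin p r L x powr r) powr (1 / p * (p - 1))"
    using pi_pos L by (simp only: powr_mult powr_powr)
  also have "1 / p * (p - 1) = 1 / conj_exp p" using p by (simp add: conj_exp_def)
  finally have e: "\<bar>?s\<bar> powr (p - 2) * ?s
      = (pi_pq p r / L) powr (p - 1) * (1 - scaled_sin p r L x powr r) powr (1 / conj_exp p)" .
  show ?thesis
    unfolding scaled_sin_slope_def scaled_sin_flux_def odd_about_middle_def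
    using e by (auto simp only: abs_minus_cancel mult_minus_right split: if_splits)
qed

text \<open>By the chain rule the factor \<open>u'\<close> contributes \<open>(1 - u\<^sup>r)\<^bsup>1/p\<^esup>\<close>, which cancels the power
\<open>(1 - u\<^sup>r)\<^bsup>1/p* - 1\<^esup>\<close> because \<open>1/p + 1/p\<^sup>* = 1\<close>. The signs of \<open>u'\<close> and of the flux
cancel, so the same equation holds on both halves of the interval.\<close>

lemma flux_derivative:
  assumes x: "x \<in> {0<..<L} - {L / 2}"
  shows "(scaled_sin_flux has_real_derivative
    - (r / conj_exp p * (pi_pq p r / L) powr p * scaled_sin p r L x powr (r - 1))) (at x)"
proof -
  let ?k = "pi_pq p r / L" and ?q = "conj_exp p" and ?u = "scaled_sin p r L"
  have k: "0 < ?k" using pi_pos L by simp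
  have u: "0 < ?u x" "?u x < 1" using scaled_sin_interior[of x] x by auto
  then have u1: "0 < 1 - ?u x powr r" using powr_less_one'[of "?u x" r] r by simp
  define e :: real where "e = (if x \<le> L / 2 then 1 else - 1)"
  have e: "e * e = 1" by (simp add: e_def)
  have slope: "scaled_sin_slope x = e * (?k * (1 - ?u x powr r) powr (1 / p))"
    by (simp add: scaled_sin_slope_def odd_about_middle_def e_def)
  have ud: "((\<lambda>x. 1 - ?u x powr r) has_real_derivative - (r * ?u x powr (r - 1) * scaled_sin_slope x)) (at x)"
    using scaled_sin_derivative[OF x] u by (auto intro!: derivative_eq_intros)
  have "((\<lambda>x. ?k powr (p - 1) * (1 - ?u x powr r) powr (1 / ?q)) has_real_derivative
      ?k powr (p - 1) * (1 / ?q * (1 - ?u x powr r) powr (1 / ?q - 1) * - (r * ?u x powr (r - 1) * scaled_sin_slope x))) (at x)"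
    using DERIV_cmult[OF DERIV_fun_powr[OF ud u1, of "1 / ?q"]] by (simp only: of_nat_1)
  then have "(scaled_sin_flux has_real_derivative
     e * (?k powr (p - 1) * (1 / ?q * (1 - ?u x powr r) powr (1 / ?q - 1) * - (r * ?u x powr (r - 1) * scaled_sin_slope x)))) (at x)"
    unfolding scaled_sin_flux_def e_def by (rule odd_about_middle_derivative[rotated]) (use x in auto)
  also have "e * (?k powr (p - 1) * (1 / ?q * (1 - ?u x powr r) powr (1 / ?q - 1) * - (r * ?u x powr (r - 1) * scaled_sin_slope x)))
     = - ((e * e) * (r / ?q) * (?k powr (p - 1) * ?k) * ((1 - ?u x powr r) powr (1 / ?q - 1) * (1 - ?u x powr r) powr (1 / p)) * ?u x powr (r - 1))"
    unfolding slope by (simp add: field_simps)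
  also note e
  also have "?k powr (p - 1) * ?k = ?k powr p"
    by (rule powr_minus_1_mult[OF less_imp_le[OF k]])
  also have "(1 - ?u x powr r) powr (1 / ?q - 1) * (1 - ?u x powr r) powr (1 / p) = 1"
  proof -
    have "1 / ?q - 1 + 1 / p = 0" using conj_exp_bounds(2)[OF p] by simp
    then show ?thesis using u1 by (simp only: powr_add[symmetric]) simp
  qed
  finally show ?thesis by simp
qed

text \<open>The derivative of \<open>u\<close> times the flux is \<open>k\<^sup>p (1 - u\<^sup>r) - (r / p\<^sup>*) k\<^sup>p u\<^sup>r\<close> with \<open>k = \<pi>\<^sub>p\<^sub>,\<^sub>r / L\<close>. Its integral
vanishes because \<open>u\<close> is zero at both end points, and this determines \<open>\<integral>u\<^sup>r\<close>.\<close>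

lemma integral_scaled_sin_powr:
  "(LINT x|leb_int L. scaled_sin p r L x powr r) = L * conj_exp p / (conj_exp p + r)"
proof -
  let ?k = "pi_pq p r / L" and ?q = "conj_exp p" and ?u = "scaled_sin p r L"
  have k: "0 < ?k" using pi_pos L by simp
  have q: "0 < ?q" using conj_exp_bounds[OF p] by simp
  have cu: "continuous_on {0..L} (\<lambda>x. ?u x powr r)"
    by (rule continuous_on_scaled_sin_powr[OF r0])
  define I where "I = integral {0..L} (\<lambda>x. ?u x powr r)"
  have "((\<lambda>x. ?k powr p * (1 - (1 + r / ?q) * ?u x powr r)) has_integral
      ?u L * scaled_sin_flux L - ?u 0 * scaled_sin_flux 0) {0..L}"
  proof (rule fundamental_theorem_of_calculus_interior_strong[of "{L / 2}"])
    fix x assume x: "x \<in> {0<..<L} - {L / 2}"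
    let ?c = "1 - ?u x powr r"
    have c0: "0 \<le> ?c" using scaled_sin_powr_le_1[of x] x by simp
    have u: "0 < ?u x" using scaled_sin_interior x by auto
    have "scaled_sin_slope x * scaled_sin_flux x = \<bar>scaled_sin_slope x\<bar> powr p"
      using flux_eq[of x] abs_powr_minus_2_mult(2)[of "scaled_sin_slope x" p] x by (simp add: mult.commute)
    also have "\<bar>scaled_sin_slope x\<bar> = ?k * ?c powr (1 / p)"
    proof -
      have "0 \<le> ?k * ?c powr (1 / p)" using k by (intro mult_nonneg_nonneg) auto
      then show ?thesis
        unfolding scaled_sin_slope_def odd_about_middle_def
        by (cases "x \<le> L / 2") (simp_all only: if_True if_False abs_minus_cancel abs_of_nonneg)
    qed
    also have "(?k * ?c powr (1 / p)) powr p = ?k powr p * ?c"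
    proof -
      have "1 / p * p = 1" using p by simp
      then show ?thesis using c0 by (simp only: powr_mult powr_powr powr_one)
    qed
    finally have 1: "scaled_sin_slope x * scaled_sin_flux x = ?k powr p * ?c" .
    have 2: "?u x powr (r - 1) * ?u x = ?u x powr r"
      by (rule powr_minus_1_mult) (use u in simp)
    have "((\<lambda>x. ?u x * scaled_sin_flux x) has_real_derivative
       scaled_sin_slope x * scaled_sin_flux x + - (r / ?q * ?k powr p * ?u x powr (r - 1)) * ?u x) (at x)"
      by (rule DERIV_mult[OF scaled_sin_derivative[OF x] flux_derivative[OF x]])
    also have "scaled_sin_slope x * scaled_sin_flux x + - (r / ?q * ?k powr p * ?u x powr (r - 1)) * ?u x
       = ?k powr p * ?c - r / ?q * ?k powr p * (?u x powr (r - 1) * ?u x)"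
      unfolding 1 by simp
    also have "\<dots> = ?k powr p * (1 - (1 + r / ?q) * ?u x powr r)"
      unfolding 2 by (simp add: algebra_simps)
    finally show "((\<lambda>x. ?u x * scaled_sin_flux x) has_vector_derivative ?k powr p * (1 - (1 + r / ?q) * ?u x powr r)) (at x)"
      unfolding has_real_derivative_iff_has_vector_derivative .
  qed (use L continuous_on_scaled_sin continuous_on_flux in \<open>auto intro!: continuous_intros\<close>)
  moreover have "((\<lambda>x. ?k powr p * (1 - (1 + r / ?q) * ?u x powr r)) has_integral ?k powr p * (L - (1 + r / ?q) * I)) {0..L}"
  proof -
    have "((\<lambda>x. 1) has_integral L) {0..L}" using has_integral_const_real[of "1::real" 0 L] L by simp
    moreover have "((\<lambda>x. ?u x powr r) has_integral I) {0..L}"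
      unfolding I_def by (intro integrable_integral integrable_continuous_real cu)
    ultimately show ?thesis by (intro has_integral_mult_right has_integral_diff)
  qed
  ultimately have "?k powr p * (L - (1 + r / ?q) * I) = ?u L * scaled_sin_flux L - ?u 0 * scaled_sin_flux 0"
    by (rule has_integral_unique[rotated])
  then have "?k powr p * (L - (1 + r / ?q) * I) = 0"
    by (simp only: scaled_sin_special mult_zero_left diff_self)
  then have "L = (1 + r / ?q) * I" using pi_pos L by simp
  then have "I = L * ?q / (?q + r)" using q r by (simp add: field_simps)
  then show ?thesis unfolding I_def by (simp add: continuous_imp_integrable_leb_int(2)[OF cu])
qed

proposition scaled_sin_weight_in_Lambda:
  assumes a: "a \<in> Linf_space (leb_int L)"
    and eq: "\<And>x. x \<in> {0<..<L} \<Longrightarrow>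
      a x * scaled_sin p r L x powr (p - 1) = r / conj_exp p * (pi_pq p r / L) powr p * scaled_sin p r L x powr (r - 1)"
  shows "a \<in> Lambda p L"
proof -
  let ?u = "scaled_sin p r L" and ?f = "\<lambda>x. - (r / conj_exp p * (pi_pq p r / L) powr p * scaled_sin p r L x powr (r - 1))"
  have cf: "continuous_on {0..L} ?f"
    using r by (intro continuous_on_minus continuous_on_mult continuous_on_const continuous_on_scaled_sin_powr) simp
  have flux: "weak_deriv L scaled_sin_flux ?f"
    by (rule weak_derivI[OF L continuous_on_flux cf finite.insertI[OF finite.emptyI] flux_derivative])
  have "weak_solution p L a ?u"
    unfolding weak_solution_def
  proof (intro conjI bexI[of _ scaled_sin_slope] ballI)
    show "?u \<in> W1p0 p L"
      by (rule W1p0I[OF p L continuous_on_scaled_sin scaled_sin_special(1,2) continuous_on_slope, of "{L / 2}"])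
        (auto intro!: scaled_sin_derivative)
    show "scaled_sin_slope \<in> Lp_space (leb_int L) p"
      using p by (intro continuous_imp_Lp_space continuous_on_slope) auto
    show "weak_deriv L ?u scaled_sin_slope"
      by (rule weak_derivI[OF L continuous_on_scaled_sin continuous_on_slope, of "{L / 2}"])
        (auto intro!: scaled_sin_derivative)
    fix \<phi> assume \<phi>: "\<phi> \<in> test_functions L"
    have "(LINT x|leb_int L. \<bar>scaled_sin_slope x\<bar> powr (p - 2) * scaled_sin_slope x * deriv \<phi> x)
        = (LINT x|leb_int L. scaled_sin_flux x * deriv \<phi> x)"
      by (rule Bochner_Integration.integral_cong) (auto simp: flux_eq)
    also have "\<dots> = - (LINT x|leb_int L. ?f x * \<phi> x)"
      using flux \<phi> unfolding weak_deriv_def by blast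
    also have "\<dots> = (LINT x|leb_int L. - (?f x * \<phi> x))" by simp
    also have "\<dots> = (LINT x|leb_int L. a x * \<bar>?u x\<bar> powr (p - 2) * ?u x * \<phi> x)"
    proof (rule Bochner_Integration.integral_cong)
      fix x assume "x \<in> space (leb_int L)"
      then have x: "x \<in> {0<..<L}" by simp
      have "\<bar>?u x\<bar> powr (p - 2) * ?u x = ?u x powr (p - 1)"
        by (rule powr_minus_2_mult) (use scaled_sin_interior(1)[OF x] in simp)
      then have "a x * \<bar>?u x\<bar> powr (p - 2) * ?u x = - ?f x"
        using eq[OF x] by (simp add: mult.assoc)
      then show "- (?f x * \<phi> x) = a x * \<bar>?u x\<bar> powr (p - 2) * ?u x * \<phi> x" by simp
    qed simp
    finally show "(LINT x|leb_int L. \<bar>scaled_sin_slope x\<bar> powr (p - 2) * scaled_sin_slope x * deriv \<phi> x)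
        = (LINT x|leb_int L. a x * \<bar>?u x\<bar> powr (p - 2) * ?u x * \<phi> x)" .
  qed
  moreover have "\<not> (AE x in leb_int L. ?u x = 0)"
  proof
    assume "AE x in leb_int L. ?u x = 0"
    then have "AE x in leb_int L. ?u x powr r = 0" by eventually_elim simp
    then have "(LINT x|leb_int L. ?u x powr r) = 0" by (rule integral_eq_zero_AE)
    then show False using L r conj_exp_bounds[OF p] unfolding integral_scaled_sin_powr by simp
  qed
  ultimately show ?thesis using a by (auto simp: Lambda_def)
qed

end

section \<open>Evaluation of the constants\<close>

lemma sobolev_peak_eq_pi:
  assumes "1 < p" "0 < r"
  shows "2 * sobolev_peak p r = pi_pq p r * (r / (conj_exp p + r))"
proof -
  let ?q = "conj_exp p"
  have q: "0 < ?q" using conj_exp_bounds[OF assms(1)] by simp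
  have "(1 / r + 1 / ?q) * Beta (1 / r) (1 / ?q + 1) = 1 / ?q * Beta (1 / r) (1 / ?q)"
    using q by (intro Beta_plus1_right) (auto dest: nonpos_Ints_nonpos)
  moreover have "B1 = r / (?q + r) * B0" if "(1 / r + 1 / ?q) * B1 = 1 / ?q * B0" for B0 B1
  proof -
    have "1 / r + 1 / ?q = (?q + r) / (r * ?q)" using q assms by (simp add: field_simps)
    then have "(?q + r) * B1 * ?q = r * B0 * ?q" using that q assms by (simp add: field_simps)
    then have "(?q + r) * B1 = r * B0" using q by simp
    then show ?thesis using q assms by (simp add: field_simps)
  qed
  ultimately have "Beta (1 / r) (1 / ?q + 1) = r / (?q + r) * Beta (1 / r) (1 / ?q)" by blast
  then show ?thesis
    unfolding sobolev_peak_def pi_pq_eq_Beta[OF assms] by simp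
qed

text \<open>The last factor is a power of \<open>\<integral>u\<^sup>r\<close> for the extremal function \<open>u\<close> (\<open>integral_scaled_sin_powr\<close>), and
the others form the coefficient in its equation. In this form the constant is visibly the norm of the extremal weight.\<close>

lemma sobolev_const_eq_pi:
  assumes "1 < p" "0 < r" "0 < L"
  shows "sobolev_const p r L = r / conj_exp p * (pi_pq p r / L) powr p * (L * conj_exp p / (conj_exp p + r)) powr (1 - p / r)"
proof -
  let ?q = "conj_exp p"
  define R Y where "R = r / (?q + r)" and "Y = L * ?q / (?q + r)"
  have q: "0 < ?q" using conj_exp_bounds[OF assms(1)] by simp
  have pos: "0 < R" "0 < Y" "0 < pi_pq p r"
    using assms q pi_pq_pos[of p r] by (auto simp: R_def Y_def intro!: divide_pos_pos)
  have rY: "r / ?q * Y = L * R" using q assms by (simp add: R_def Y_def field_simps)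
  have RR: "R powr (p - 1) * R = R powr p" "L powr (p - 1) * L = L powr p" "Y powr (1 - p / r) * Y powr (p / r) = Y"
    using pos assms powr_add[of R "p - 1" 1] powr_add[of L "p - 1" 1] powr_add[of Y "1 - p / r" "p / r"] by auto
  have "sobolev_const p r L = (pi_pq p r * R) powr p / (Y powr (p / r) * (L * R) powr (p - 1))"
    unfolding sobolev_const_def sobolev_peak_eq_pi[OF assms(1,2)] R_def Y_def by simp
  also have "\<dots> = r / ?q * (pi_pq p r / L) powr p * Y powr (1 - p / r)"
  proof -
    have "r / ?q * (pi_pq p r / L) powr p * Y powr (1 - p / r) * (Y powr (p / r) * (L * R) powr (p - 1))
       = r / ?q * (Y powr (1 - p / r) * Y powr (p / r)) * (pi_pq p r powr p / L powr p) * (L powr (p - 1) * R powr (p - 1))"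
      using pos assms by (simp add: powr_mult powr_divide)
    also have "\<dots> = (L powr (p - 1) * L) * (R powr (p - 1) * R) * (pi_pq p r powr p / L powr p)"
      unfolding RR(3) rY by simp
    also have "\<dots> = (pi_pq p r * R) powr p"
      unfolding RR using pos assms by (simp add: powr_mult)
    finally show ?thesis
      using pos assms by (simp add: field_simps)
  qed
  finally show ?thesis unfolding Y_def .
qed

text \<open>The arithmetic of exponents behind the choice \<open>r = p q\<^sup>*\<close>.\<close>

lemma conj_exp_mult_eq:
  assumes "1 < p" "1 < q"
  shows "p * conj_exp q / conj_exp p = (p - 1) * conj_exp q" "1 - p / (p * conj_exp q) = 1 / q"
    "p / (q - 1) * q = p * conj_exp q" "p / (q - 1) + (p - 1) = p * conj_exp q - 1"
    "conj_exp p / (conj_exp p + p * conj_exp q) = (q - 1) / (p * q - 1)"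
proof -
  have "0 < p * q - 1" using assms by (simp add: less_1_mult)
  then show "p * conj_exp q / conj_exp p = (p - 1) * conj_exp q" "1 - p / (p * conj_exp q) = 1 / q"
    "p / (q - 1) * q = p * conj_exp q" "p / (q - 1) + (p - 1) = p * conj_exp q - 1"
    using assms by (auto simp: conj_exp_def field_simps)
  have "conj_exp p + p * conj_exp q = p * (p * q - 1) / ((p - 1) * (q - 1))"
    using assms by (simp add: conj_exp_def field_simps)
  then show "conj_exp p / (conj_exp p + p * conj_exp q) = (q - 1) / (p * q - 1)"
    using assms by (simp add: conj_exp_def)
qed

lemma sin_p_integral_eq_pi:
  assumes "1 < p" "1 < q"
  shows "sin_p_integral p q = conj_exp q * pi_pq p (p * conj_exp q) / 2"
  using sin_p_integral_eq_Beta[OF assms] pi_pq_eq_Beta[of p "p * conj_exp q"] assms conj_exp_bounds[OF assms(2)]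
  by simp

lemma bound_q_eq_sobolev_const:
  assumes p: "1 < p" and q: "1 < q" and L: "0 < L"
  shows "bound_q p L q = sobolev_const p (p * conj_exp q) L"
proof -
  define P where "P = pi_pq p (p * conj_exp q)"
  have r: "0 < p * conj_exp q" using p conj_exp_bounds[OF q] by simp
  have P: "0 < P" unfolding P_def by (rule pi_pq_pos[OF p r])
  define s where "s = q - 1"
  define t where "t = p * q - 1"
  have s: "0 < s" "q - 1 = s" using q by (auto simp: s_def)
  have t: "0 < t" "p * q - 1 = t" using p q by (auto simp: t_def less_1_mult)
  have cq: "conj_exp q = q / s" by (simp add: conj_exp_def s)
  have S: "sobolev_const p (p * conj_exp q) L = (p - 1) * (q / s) * (P / L) powr p * (L * (s / t)) powr (1 / q)"
    using sobolev_const_eq_pi[OF p r L] conj_exp_mult_eq[OF p q] unfolding P_def[symmetric]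
    by (simp only: times_divide_eq_right[of L, symmetric] s t) (simp add: cq)
  have "bound_q p L q = 2 powr p * (p - 1) * s powr (p - 1 + 1 / q) / (L powr (p - 1 / q) * q powr (p - 1) * t powr (1 / q))
      * (q / s * P / 2) powr p"
    unfolding bound_q_def sin_p_integral_eq_pi[OF p q] P_def s t cq by (rule refl)
  also have "(q / s * P / 2) powr p = (q powr (p - 1) * q) / (s powr (p - 1) * s) * P powr p / 2 powr p"
  proof -
    have "q powr (p - 1) * q = q powr p" "s powr (p - 1) * s = s powr p"
      using powr_minus_1_mult[of q p] powr_minus_1_mult[of s p] q s by auto
    then show ?thesis using q s P by (simp add: powr_mult powr_divide)
  qed
  also have "s powr (p - 1 + 1 / q) = s powr (p - 1) * s powr (1 / q)" by (rule powr_add)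
  also have "L powr (p - 1 / q) = L powr p / L powr (1 / q)" by (rule powr_diff)
  also have "2 powr p * (p - 1) * (s powr (p - 1) * s powr (1 / q)) /
        (L powr p / L powr (1 / q) * q powr (p - 1) * t powr (1 / q)) *
      ((q powr (p - 1) * q) / (s powr (p - 1) * s) * P powr p / 2 powr p)
    = (p - 1) * (q / s) * (P powr p / L powr p) * (L powr (1 / q) * (s powr (1 / q) / t powr (1 / q)))"
    using q s t L by (simp add: divide_simps)
  also have "\<dots> = sobolev_const p (p * conj_exp q) L"
    unfolding S using q s t L P by (simp add: powr_mult powr_divide)
  finally show ?thesis .
qed

lemma bound_inf_eq_sobolev_const:
  assumes p: "1 < p" and L: "0 < L"
  shows "bound_inf p L = sobolev_const p p L"
proof -
  have "p / conj_exp p = p - 1" using p by (simp add: conj_exp_def)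
  moreover define Y where "Y = L * conj_exp p / (conj_exp p + p)"
  have "0 < Y"
    unfolding Y_def using p L conj_exp_bounds[OF p] by (intro divide_pos_pos mult_pos_pos) auto
  ultimately show ?thesis
    using sobolev_const_eq_pi[OF p _ L, of p, folded Y_def] p by (simp add: bound_inf_def)
qed

lemma continuous_imp_Linf_space:
  assumes "continuous_on {0..L} f"
  shows "f \<in> Linf_space (leb_int L)"
proof -
  obtain C where "\<And>x. x \<in> {0..L} \<Longrightarrow> \<bar>f x\<bar> \<le> C"
    using compact_imp_bounded[OF compact_continuous_image[OF assms compact_Icc]]
    unfolding bounded_iff by (metis image_eqI real_norm_def)
  then have "AE x in leb_int L. \<bar>f x\<bar> \<le> C" by (intro AE_I2) auto
  then show ?thesis
    using continuous_imp_integrable_leb_int(1)[OF assms] by (auto simp: Linf_space_def)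
qed

lemma extremal_q_eq:
  "extremal_q p L q x = (p - 1) * conj_exp q * (pi_pq p (p * conj_exp q) / L) powr p
    * scaled_sin p (p * conj_exp q) L x powr (p / (q - 1))"
  by (simp add: extremal_q_def scaled_sin_def Let_def)

lemma extremal_exponent:
  assumes "1 < p" "1 < q" shows "1 < p * conj_exp q"
  using assms conj_exp_bounds(1)[OF assms(2)] by (simp add: less_1_mult)

lemma extremal_q_in_Lambda:
  assumes p: "1 < p" and q: "1 < q" and L: "0 < L"
  shows "extremal_q p L q \<in> Lambda p L"
proof (rule scaled_sin_weight_in_Lambda[OF p extremal_exponent[OF p q] L])
  have "continuous_on {0..L} (extremal_q p L q)"
    unfolding extremal_q_eq[abs_def] using p q
    by (intro continuous_on_mult continuous_on_const continuous_on_scaled_sin_powr[OF p extremal_exponent[OF p q] L]) simp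
  then show "extremal_q p L q \<in> Linf_space (leb_int L)" by (rule continuous_imp_Linf_space)
  fix x assume "x \<in> {0<..<L}"
  show "extremal_q p L q x * scaled_sin p (p * conj_exp q) L x powr (p - 1)
      = p * conj_exp q / conj_exp p * (pi_pq p (p * conj_exp q) / L) powr p
        * scaled_sin p (p * conj_exp q) L x powr (p * conj_exp q - 1)"
    unfolding extremal_q_eq conj_exp_mult_eq(1)[OF p q] conj_exp_mult_eq(4)[OF p q, symmetric] powr_add
    by (simp only: mult.assoc)
qed

lemma Lp_norm_extremal_q:
  assumes p: "1 < p" and q: "1 < q" and L: "0 < L"
  shows "Lp_norm (leb_int L) q (extremal_q p L q) = bound_q p L q"
proof -
  let ?r = "p * conj_exp q"
  define K where "K = (p - 1) * conj_exp q * (pi_pq p ?r / L) powr p"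
  have r: "1 < ?r" by (rule extremal_exponent[OF p q])
  define Y where "Y = L * conj_exp p / (conj_exp p + ?r)"
  have K: "0 \<le> K" using p conj_exp_bounds(3)[OF q] by (simp add: K_def)
  have "(LINT x|leb_int L. \<bar>extremal_q p L q x\<bar> powr q) = (LINT x|leb_int L. K powr q * scaled_sin p ?r L x powr ?r)"
  proof (rule Bochner_Integration.integral_cong)
    fix x
    show "\<bar>extremal_q p L q x\<bar> powr q = K powr q * scaled_sin p ?r L x powr ?r"
      unfolding extremal_q_eq K_def[symmetric] using K conj_exp_mult_eq(3)[OF p q]
      by (simp add: abs_mult powr_mult powr_powr)
  qed simp
  also have "\<dots> = K powr q * Y"
    unfolding Y_def integral_scaled_sin_powr[OF p r L, symmetric] by simp
  finally have "Lp_norm (leb_int L) q (extremal_q p L q) = K * Y powr (1 / q)"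
    using K q by (simp add: Lp_norm_def powr_mult powr_powr)
  then show ?thesis
    using r sobolev_const_eq_pi[OF p _ L, of ?r, folded Y_def]
    unfolding bound_q_eq_sobolev_const[OF p q L] K_def conj_exp_mult_eq(1,2)[OF p q] by simp
qed

lemma extremal_inf_in_Lambda:
  assumes p: "1 < p" and L: "0 < L"
  shows "extremal_inf p L \<in> Lambda p L"
proof (rule scaled_sin_weight_in_Lambda[OF p p L])
  show "extremal_inf p L \<in> Linf_space (leb_int L)"
    unfolding extremal_inf_def[abs_def] by (intro continuous_imp_Linf_space continuous_on_const)
  show "extremal_inf p L x * scaled_sin p p L x powr (p - 1)
      = p / conj_exp p * (pi_p p / L) powr p * scaled_sin p p L x powr (p - 1)" for x
    using p by (simp add: extremal_inf_def conj_exp_def)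
qed

lemma Linf_norm_extremal_inf:
  assumes p: "1 < p" and L: "0 < L"
  shows "Linf_norm (leb_int L) (extremal_inf p L) = bound_inf p L"
proof -
  have "esssup (leb_int L) (\<lambda>x. ereal \<bar>extremal_inf p L x\<bar>) = ereal (bound_inf p L)"
    unfolding extremal_inf_def bound_inf_def
    using p L emeasure_leb_int[OF L] by (subst esssup_const) (auto simp: abs_mult)
  then show ?thesis by (simp add: Linf_norm_def)
qed

theorem theorem1p3:
  fixes p L :: real
  assumes "1 < p" and "0 < L"
  shows
    "(\<forall>q::real. 1 < q \<longrightarrow>
        (\<forall>a\<in>Lambda p L. Lp_norm (leb_int L) q a \<ge> bound_q p L q)
      \<and> sin_p_integral p q = conj_exp q * pi_pq p (p * conj_exp q) / 2
      \<and> sin_p_integral p q = 1 / p * Beta (1 / conj_exp p) (1 / (p * conj_exp q))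
      \<and> (\<forall>C. (\<forall>a\<in>Lambda p L. Lp_norm (leb_int L) q a \<ge> C) \<longrightarrow> C \<le> bound_q p L q)
      \<and> extremal_q p L q \<in> Lambda p L
      \<and> Lp_norm (leb_int L) q (extremal_q p L q) = bound_q p L q)
   \<and> (\<forall>a\<in>Lambda p L. Linf_norm (leb_int L) a \<ge> bound_inf p L)
   \<and> (\<forall>C. (\<forall>a\<in>Lambda p L. Linf_norm (leb_int L) a \<ge> C) \<longrightarrow> C \<le> bound_inf p L)
   \<and> extremal_inf p L \<in> Lambda p L
   \<and> Linf_norm (leb_int L) (extremal_inf p L) = bound_inf p L"
proof (intro conjI allI impI ballI)
  fix q :: real assume q: "1 < q"
  show "bound_q p L q \<le> Lp_norm (leb_int L) q a" if "a \<in> Lambda p L" for a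
    unfolding bound_q_eq_sobolev_const[OF assms(1) q assms(2)]
    by (rule Lambda_Lp_norm_ge[OF assms q that])
  show "sin_p_integral p q = conj_exp q * pi_pq p (p * conj_exp q) / 2"
    by (rule sin_p_integral_eq_pi[OF assms(1) q])
  show "sin_p_integral p q = 1 / p * Beta (1 / conj_exp p) (1 / (p * conj_exp q))"
    unfolding sin_p_integral_eq_Beta[OF assms(1) q] by (simp add: Beta_commute)
  show in_Lambda: "extremal_q p L q \<in> Lambda p L"
    by (rule extremal_q_in_Lambda[OF assms(1) q assms(2)])
  show norm: "Lp_norm (leb_int L) q (extremal_q p L q) = bound_q p L q"
    by (rule Lp_norm_extremal_q[OF assms(1) q assms(2)])
  show "C \<le> bound_q p L q" if "\<forall>a\<in>Lambda p L. C \<le> Lp_norm (leb_int L) q a" for C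
    using that in_Lambda norm by fastforce
next
  show "bound_inf p L \<le> Linf_norm (leb_int L) a" if "a \<in> Lambda p L" for a
    unfolding bound_inf_eq_sobolev_const[OF assms] by (rule Lambda_Linf_norm_ge[OF assms that])
  show in_Lambda: "extremal_inf p L \<in> Lambda p L" by (rule extremal_inf_in_Lambda[OF assms])
  show norm: "Linf_norm (leb_int L) (extremal_inf p L) = bound_inf p L"
    by (rule Linf_norm_extremal_inf[OF assms])
  show "C \<le> bound_inf p L" if "\<forall>a\<in>Lambda p L. C \<le> Linf_norm (leb_int L) a" for C
    using that in_Lambda norm by fastforce
qed

end
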